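(* Let $\Sigma$ be the system $x(t+1)=Ax(t)+Bu(t)+Ed(t)$, $y(t)=Cx(t)$, $t\in\mathbb{Z}_+$, with unknown matrices, where $\operatorname{rank}(E)=q$, $\operatorname{rank}(C)=p$ and $C=[\,C_1\mid C_2\,]$ with $C_2\in\mathbb{R}^{p\times p}$ nonsingular. Given historical data $(u_d,y_d,x_d)$ generated by $\Sigma$ on $[0,T-1]$ (together with an unmeasured disturbance sequence $d_d$), such that the matrix $\begin{bmatrix} U_p^\top & D_p^\top & X_p^\top\end{bmatrix}^\top$ has full row rank $m+q+n$, there exists a reduced-order unknown-input observer (rUIO) for $\Sigma$ of the form $$\begin{aligned} z(t+1)&=A_{UIO}z(t)+B_{UIO}^u u(t)+B_{UIO}^y y(t),\\ \hat x_1(t)&=z(t)+D_{UIO}y(t),\\ \hat x_2(t)&=-C_2^{-1}C_1z(t)+(C_2^{-1}-C_2^{-1}C_1D_{UIO})y(t),\end{aligned}$$ with $z(t)\in\mathbb{R}^{n-p}$, designed from the historical data, if and only if there exists a matrix $[\,S_1\mid S_2\mid S_3\mid S_4\,]\in\mathbb{R}^{(n-p)\times(m+2p+n-p)}$, with $S_4$ Schur stable, such that $$X_{f,1}=[\,S_1\mid S_2\mid S_3\mid S_4\,]\begin{bmatrix}U_p\\ Y_p\\ Y_f\\ X_{p,1}\end{bmatrix}.$$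
   Context: System: $x(t)\in\mathbb{R}^n$ is the state, $u(t)\in\mathbb{R}^m$ the known input, $d(t)\in\mathbb{R}^q$ the unknown input (disturbance), $y(t)\in\mathbb{R}^p$ the output; $A,B,E,C$ are real matrices of compatible sizes, $E$ has full column rank, $C$ has full row rank, and $C=[\,C_1\mid C_2\,]$ with $C_1\in\mathbb{R}^{p\times(n-p)}$ and $C_2\in\mathbb{R}^{p\times p}$ nonsingular. The state is partitioned as $x=[x_1^\top\ x_2^\top]^\top$ with $x_1\in\mathbb{R}^{n-p}$, $x_2\in\mathbb{R}^p$. rUIO: a system of the displayed form, with real matrices $A_{UIO}\in\mathbb{R}^{(n-p)\times(n-p)}$, $B^u_{UIO}\in\mathbb{R}^{(n-p)\times m}$, $B^y_{UIO},D_{UIO}\in\mathbb{R}^{(n-p)\times p}$ and output $\hat x(t)=[\hat x_1(t)^\top\ \hat x_2(t)^\top]^\top\in\mathbb{R}^n$, is a reduced-order unknown-input observer for $\Sigma$ if $e(t)=x(t)-\hat x(t)$ converges to $0$ as $t\to\infty$ for every choice of $z(0)$ and every input/output pair $(\{u(t)\}_{t\in\mathbb{Z}_+},\{y(t)\}_{t\in\mathbb{Z}_+})$ of $\Sigma$ (generated by an arbitrary $x(0)$ and an arbitrary disturbance). Designed from the historical data: the matrices $A_{UIO},B^u_{UIO},B^y_{UIO},D_{UIO}$ are built using the collected data, without knowledge of the system matrices. The construction is through a solution $[\,S_1\mid S_2\mid S_3\mid S_4\,]$ of the displayed data equation, by setting $A_{UIO}=S_4$, $B^u_{UIO}=S_1$,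 $B^y_{UIO}=S_2+S_4S_3$, $D_{UIO}=S_3$; conversely, observer matrices correspond to the solution $S_1=B^u_{UIO}$, $S_2=B^y_{UIO}-A_{UIO}D_{UIO}$, $S_3=D_{UIO}$, $S_4=A_{UIO}$. Here $S_1$ has $m$ columns, $S_2$ and $S_3$ have $p$ columns each, and $S_4$ has $n-p$ columns. The matrix $C$, hence $C_1$ and $C_2$, is itself obtained from the data as $C=Y_pX_p^\top(X_pX_p^\top)^{-1}$. A square real matrix is Schur stable if all its eigenvalues have modulus strictly less than $1$. Data: the historical sequences are $u_d=\{u_d(t)\}_{t=0}^{T-2}$, $y_d=\{y_d(t)\}_{t=0}^{T-1}$, $x_d=\{x_d(t)\}_{t=0}^{T-1}$, and the unmeasured $d_d=\{d_d(t)\}_{t=0}^{T-2}$, satisfying $x_d(t+1)=Ax_d(t)+Bu_d(t)+Ed_d(t)$ for $0\le t\le T-2$ and $y_d(t)=Cx_d(t)$ for $0\le t\le T-1$. Write $x_d(t)=[x_{d,1}(t)^\top\ x_{d,2}(t)^\top]^\top$ with $x_{d,1}(t)\in\mathbb{R}^{n-p}$, $x_{d,2}(t)\in\mathbb{R}^{p}$. The data matrices (each with $T-1$ columns) are $U_p=[u_d(0)\ \dots\ u_d(T-2)]$, $D_p=[d_d(0)\ \dots\ d_d(T-2)]$, $X_p=[x_d(0)\ \dots\ x_d(T-2)]$, $Y_p=[y_d(0)\ \dots\ y_d(T-2)]$, $Y_f=[y_d(1)\ \dots\ y_d(T-1)]$, $X_{p,1}=[x_{d,1}(0)\ \dots\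 x_{d,1}(T-2)]$, $X_{f,1}=[x_{d,1}(1)\ \dots\ x_{d,1}(T-1)]$. *)

theory Defs
  imports
    "HOL-Analysis.Analysis"
    "Jordan_Normal_Form.DL_Rank"
    "Jordan_Normal_Form.Gauss_Jordan_Elimination"
    "Jordan_Normal_Form.Spectral_Radius"
begin

text \<open>
  Matrices carry their dimensions as natural numbers, so that \<open>n\<close>, \<open>p\<close> and \<open>n - p\<close> can occur
  in one statement; all dimensions may be zero.
\<close>

definition append_cols :: "'a :: zero mat \<Rightarrow> 'a mat \<Rightarrow> 'a mat" (infixr \<open>@\<^sub>c\<close> 65) where
  "A @\<^sub>c B = four_block_mat A B (0\<^sub>m 0 (dim_col A)) (0\<^sub>m 0 (dim_col B))"

text \<open>The inverse matrix; only meaningful if \<open>A\<close> is invertible.\<close>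

definition mat_inv :: "'a :: field mat \<Rightarrow> 'a mat" where
  "mat_inv A = the (mat_inverse A)"

definition schur_stable :: "real mat \<Rightarrow> bool" where
  "schur_stable A \<longleftrightarrow>
     square_mat A \<and> (\<forall>k. eigenvalue (map_mat complex_of_real A) k \<longrightarrow> cmod k < 1)"

text \<open>The type of vectors has no topology; convergence in \<open>\<real>\<^sup>n\<close> is componentwise.\<close>

definition vec_tendsto_zero :: "nat \<Rightarrow> (nat \<Rightarrow> real vec) \<Rightarrow> bool" where
  "vec_tendsto_zero n e \<longleftrightarrow> (\<forall>i<n. (\<lambda>t. e t $ i) \<longlonglongrightarrow> 0)"

definition sys_trajectory ::
  "real mat \<Rightarrow> real mat \<Rightarrow> real mat \<Rightarrow> real mat \<Rightarrow>
   (nat \<Rightarrow> real vec) \<Rightarrow> (nat \<Rightarrow> real vec) \<Rightarrow> (nat \<Rightarrow> real vec) \<Rightarrow> (nat \<Rightarrow> real vec) \<Rightarrow> bool" where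
  "sys_trajectory A B E C u d x y \<longleftrightarrow>
     (\<forall>t. u t \<in> carrier_vec (dim_col B) \<and> d t \<in> carrier_vec (dim_col E) \<and>
          x t \<in> carrier_vec (dim_col A) \<and>
          x (Suc t) = A *\<^sub>v x t + B *\<^sub>v u t + E *\<^sub>v d t \<and>
          y t = C *\<^sub>v x t)"

definition data_trajectory ::
  "nat \<Rightarrow> real mat \<Rightarrow> real mat \<Rightarrow> real mat \<Rightarrow> real mat \<Rightarrow>
   (nat \<Rightarrow> real vec) \<Rightarrow> (nat \<Rightarrow> real vec) \<Rightarrow> (nat \<Rightarrow> real vec) \<Rightarrow> (nat \<Rightarrow> real vec) \<Rightarrow> bool" where
  "data_trajectory T A B E C u d x y \<longleftrightarrow>
     (\<forall>t<T - 1. u t \<in> carrier_vec (dim_col B) \<and> d t \<in> carrier_vec (dim_col E) \<and>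
          x (Suc t) = A *\<^sub>v x t + B *\<^sub>v u t + E *\<^sub>v d t) \<and>
     (\<forall>t<T. x t \<in> carrier_vec (dim_col A) \<and> y t = C *\<^sub>v x t)"

definition observer_state ::
  "real mat \<Rightarrow> real mat \<Rightarrow> real mat \<Rightarrow>
   (nat \<Rightarrow> real vec) \<Rightarrow> (nat \<Rightarrow> real vec) \<Rightarrow> (nat \<Rightarrow> real vec) \<Rightarrow> bool" where
  "observer_state AU Bu By u y z \<longleftrightarrow>
     (\<forall>t. z t \<in> carrier_vec (dim_col AU) \<and>
          z (Suc t) = AU *\<^sub>v z t + Bu *\<^sub>v u t + By *\<^sub>v y t)"

definition observer_estimate ::
  "real mat \<Rightarrow> real mat \<Rightarrow> real mat \<Rightarrow> real vec \<Rightarrow> real vec \<Rightarrow> real vec" where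
  "observer_estimate C1 C2 DU z y =
     (z + DU *\<^sub>v y) @\<^sub>v
     ((- (mat_inv C2 * C1)) *\<^sub>v z + (mat_inv C2 - mat_inv C2 * C1 * DU) *\<^sub>v y)"

definition is_rUIO ::
  "real mat \<Rightarrow> real mat \<Rightarrow> real mat \<Rightarrow> real mat \<Rightarrow> real mat \<Rightarrow>
   real mat \<Rightarrow> real mat \<Rightarrow> real mat \<Rightarrow> real mat \<Rightarrow> bool" where
  "is_rUIO A B E C1 C2 AU Bu By DU \<longleftrightarrow>
     AU \<in> carrier_mat (dim_col C1) (dim_col C1) \<and>
     Bu \<in> carrier_mat (dim_col C1) (dim_col B) \<and>
     By \<in> carrier_mat (dim_col C1) (dim_row C1) \<and>
     DU \<in> carrier_mat (dim_col C1) (dim_row C1) \<and>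
     (\<forall>u d x y z. sys_trajectory A B E (C1 @\<^sub>c C2) u d x y \<longrightarrow> observer_state AU Bu By u y z \<longrightarrow>
        vec_tendsto_zero (dim_row A) (\<lambda>t. x t - observer_estimate C1 C2 DU (z t) (y t)))"

text \<open>\<open>[w(0) \<dots> w(T-2)]\<close> and \<open>[w(1) \<dots> w(T-1)]\<close> for a sequence of vectors of length \<open>k\<close>.\<close>

definition past_mat :: "nat \<Rightarrow> nat \<Rightarrow> (nat \<Rightarrow> real vec) \<Rightarrow> real mat" where
  "past_mat T k w = mat_of_cols k (map w [0..<T - 1])"

definition future_mat :: "nat \<Rightarrow> nat \<Rightarrow> (nat \<Rightarrow> real vec) \<Rightarrow> real mat" where
  "future_mat T k w = mat_of_cols k (map w [1..<T])"

text \<open>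
  \<open>[S1 | S2 | S3 | S4]\<close> is a real solution, of size \<open>(n - p) \<times> (m + 2p + n - p)\<close>, of the
  data equation.
\<close>

definition data_solution ::
  "nat \<Rightarrow> nat \<Rightarrow> nat \<Rightarrow> nat \<Rightarrow> (nat \<Rightarrow> real vec) \<Rightarrow> (nat \<Rightarrow> real vec) \<Rightarrow> (nat \<Rightarrow> real vec) \<Rightarrow>
   real mat \<Rightarrow> real mat \<Rightarrow> real mat \<Rightarrow> real mat \<Rightarrow> bool" where
  "data_solution T n m p u y x S1 S2 S3 S4 \<longleftrightarrow>
     S1 \<in> carrier_mat (n - p) m \<and> S2 \<in> carrier_mat (n - p) p \<and>
     S3 \<in> carrier_mat (n - p) p \<and> S4 \<in> carrier_mat (n - p) (n - p) \<and>
     future_mat T (n - p) (\<lambda>t. vec_first (x t) (n - p)) =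
       (S1 @\<^sub>c S2 @\<^sub>c S3 @\<^sub>c S4) *
       (past_mat T m u @\<^sub>r past_mat T p y @\<^sub>r future_mat T p y @\<^sub>r
        past_mat T (n - p) (\<lambda>t. vec_first (x t) (n - p)))"

text \<open>
  The observer matrices are obtained from some solution of the data equation (no stability is
  demanded here), and the matrix \<open>C\<close> entering the observer output is the one
  computed from the data.
\<close>

definition designed_from_data ::
  "nat \<Rightarrow> nat \<Rightarrow> nat \<Rightarrow> nat \<Rightarrow> (nat \<Rightarrow> real vec) \<Rightarrow> (nat \<Rightarrow> real vec) \<Rightarrow> (nat \<Rightarrow> real vec) \<Rightarrow>
   real mat \<Rightarrow> real mat \<Rightarrow> real mat \<Rightarrow> real mat \<Rightarrow> real mat \<Rightarrow> bool" where
  "designed_from_data T n m p u y x C AU Bu By DU \<longleftrightarrow>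
     (let Xp = past_mat T n x; Yp = past_mat T p y
      in C = Yp * Xp\<^sup>T * mat_inv (Xp * Xp\<^sup>T)) \<and>
     (\<exists>S1 S2 S3 S4. data_solution T n m p u y x S1 S2 S3 S4 \<and>
        AU = S4 \<and> Bu = S1 \<and> By = S2 + S4 * S3 \<and> DU = S3)"

end

theory Submission
  imports Defs
begin

text \<open>
  Write \<open>k = n - p\<close>, let \<open>P\<close> select the first \<open>k\<close> components of a state, and let the columns of
  \<open>L\<close>, with \<open>P L = 1\<close>, span the kernel of \<open>C\<close>.  Everything is expressed through the matrix
  \<open>F = P - D C\<close>, where \<open>D\<close> is the feed-through matrix of an observer: the full estimation error is
  \<open>L (F x(t) - z(t))\<close>, so the observer is a rUIO iff \<open>F x(t) - z(t)\<close> always tends to zero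
  (\<open>is_rUIO_iff_reduced_error\<close>).  The matrices of the form \<open>P - D C\<close> are exactly those with
  \<open>F L = 1\<close>, because a matrix that vanishes on the kernel of \<open>C\<close> factors through \<open>C\<close>.

  \<^emph>\<open>From the data equation to an observer.\<close>  The data equation says that a fixed linear expression in
  \<open>(u, d, x)\<close> vanishes at every sample.  As the samples span the whole space, it vanishes
  identically, which means \<open>F B = S1\<close>, \<open>F E = 0\<close> and \<open>F A = S2 C + S4 P\<close>
  (\<open>data_equation_imp_observer_equations\<close>).  Under these equations the reduced error obeys
  \<open>e(t+1) = S4 e(t)\<close>, and \<open>S4\<close> is Schur stable.  The same spanning property makes \<open>X X\<^sup>T\<close>
  invertible for the state data matrix \<open>X\<close>, so that \<open>C\<close> is recovered from the data.

  \<^emph>\<open>From an observer to the data equation.\<close>  The matrices of a given rUIO need not solve the data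
  equation: if \<open>A\<close> is Schur stable and there are no inputs, then zero matrices form a rUIO, whatever
  \<open>A\<close> is.  What has to be produced is some \<open>F\<close> with \<open>F L = 1\<close>, \<open>F E = 0\<close> and \<open>F A L\<close> Schur stable;
  then \<open>S4 = F A L\<close> works.  Let \<open>H t\<close> be the matrix that maps the initial
  state to the reduced error at time \<open>t\<close> of the given observer, started in zero and without inputs
  (\<open>error_response\<close>).  Then \<open>H 0 L = 1\<close>, \<open>H (t+1) L = H t A L\<close> and \<open>H t L\<close> tends to zero.
  Moreover \<open>H t E = 0\<close> for all \<open>t\<close>: these matrices form the impulse response from the disturbance
  to the error, and a nonzero impulse response would let some disturbance keep the error away from zero
  (\<open>convolution_tendsto_zero_imp_zero\<close>).

  Now equip the state space with the semidefinite form \<open>Q(v) = \<Sum>t<N. |H t v|\<^sup>2\<close> and let \<open>F\<close> be such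
  that \<open>L F\<close> is the \<open>Q\<close>-orthogonal projection onto the kernel of \<open>C\<close>.  Then \<open>F E = 0\<close>, because
  \<open>Q\<close> vanishes on the range of \<open>E\<close>.  A projection does not increase \<open>Q\<close>, and the sum telescopes, so
  \<open>Q(L F A L v) \<le> Q(A L v) = Q(L v) - |v|\<^sup>2 + |H N L v|\<^sup>2 < Q(L v)\<close> as soon as \<open>N\<close> is large.  Hence
  \<open>v \<mapsto> Q(L v)\<close> is a Lyapunov function for \<open>F A L\<close> (\<open>stabilizing_left_inverse\<close>).
\<close>

text \<open>The dot and the dollar sign are the scalar product and the index of vectors of variable dimension.\<close>

unbundle no inner_syntax
unbundle no vec_syntax

section \<open>Schur stability\<close>

text \<open>
  With \<open>w = a + \<i> b\<close> and \<open>\<mu> = \<alpha> + \<i> \<beta>\<close>, the left-hand side is the sum of the form over the real and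
  the imaginary part of \<open>\<mu> w\<close>: a real quadratic form extends to complex vectors so that
  scaling by \<open>\<mu>\<close> multiplies it by \<open>|\<mu>|\<^sup>2\<close>.  The mixed terms of the two parts cancel.
\<close>

lemma quadratic_form_rotation:
  fixes Y :: "real mat"
  assumes Y: "Y \<in> carrier_mat k k" and a: "a \<in> carrier_vec k" and b: "b \<in> carrier_vec k"
  shows "(\<alpha> \<cdot>\<^sub>v a - \<beta> \<cdot>\<^sub>v b) \<bullet> (Y *\<^sub>v (\<alpha> \<cdot>\<^sub>v a - \<beta> \<cdot>\<^sub>v b)) + (\<alpha> \<cdot>\<^sub>v b + \<beta> \<cdot>\<^sub>v a) \<bullet> (Y *\<^sub>v (\<alpha> \<cdot>\<^sub>v b + \<beta> \<cdot>\<^sub>v a))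
       = (\<alpha>\<^sup>2 + \<beta>\<^sup>2) * (a \<bullet> (Y *\<^sub>v a) + b \<bullet> (Y *\<^sub>v b))"
proof -
  have Ya: "Y *\<^sub>v a \<in> carrier_vec k" and Yb: "Y *\<^sub>v b \<in> carrier_vec k" using Y a b by auto
  have 1: "Y *\<^sub>v (\<alpha> \<cdot>\<^sub>v a - \<beta> \<cdot>\<^sub>v b) = \<alpha> \<cdot>\<^sub>v (Y *\<^sub>v a) - \<beta> \<cdot>\<^sub>v (Y *\<^sub>v b)"
    using Y a b by (simp add: mult_minus_distrib_mat_vec[of _ k k] mult_mat_vec[of _ k k])
  have 2: "Y *\<^sub>v (\<alpha> \<cdot>\<^sub>v b + \<beta> \<cdot>\<^sub>v a) = \<alpha> \<cdot>\<^sub>v (Y *\<^sub>v b) + \<beta> \<cdot>\<^sub>v (Y *\<^sub>v a)"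
    using Y a b by (simp add: mult_add_distrib_mat_vec[of _ k k] mult_mat_vec[of _ k k])
  show ?thesis unfolding 1 2
    using a b Ya Yb
    by (simp add: minus_scalar_prod_distrib[of _ k] scalar_prod_minus_distrib[of _ k]
        add_scalar_prod_distrib[of _ k] scalar_prod_add_distrib[of _ k])
       (simp add: algebra_simps power2_eq_square)
qed

text \<open>
  Lyapunov's criterion.  The form is evaluated on the real and imaginary parts of a complex
  eigenvector for \<open>\<mu>\<close>; applying \<open>S\<close> multiplies the sum of the two values by \<open>|\<mu>|\<^sup>2\<close> and makes it
  smaller.
\<close>

lemma schur_stable_if_decreasing_quadratic_form:
  fixes S Y :: "real mat"
  assumes S: "S \<in> carrier_mat k k" and Y: "Y \<in> carrier_mat k k"
    and pos: "\<And>v. v \<in> carrier_vec k \<Longrightarrow> 0 \<le> v \<bullet> (Y *\<^sub>v v)"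
    and dec: "\<And>v. v \<in> carrier_vec k \<Longrightarrow> v \<noteq> 0\<^sub>v k \<Longrightarrow> (S *\<^sub>v v) \<bullet> (Y *\<^sub>v (S *\<^sub>v v)) < v \<bullet> (Y *\<^sub>v v)"
  shows "schur_stable S"
  unfolding schur_stable_def
proof (intro conjI allI impI)
  show "square_mat S" using S by auto
next
  fix \<mu> assume "eigenvalue (map_mat complex_of_real S) \<mu>"
  then obtain w where w: "w \<in> carrier_vec k" "w \<noteq> 0\<^sub>v k"
    and ew: "map_mat complex_of_real S *\<^sub>v w = \<mu> \<cdot>\<^sub>v w"
    using S unfolding eigenvalue_def eigenvector_def by auto
  define a b where "a = map_vec Re w" and "b = map_vec Im w"
  define V where "V v = v \<bullet> (Y *\<^sub>v v)" for v
  have a: "a \<in> carrier_vec k" and b: "b \<in> carrier_vec k" using w unfolding a_def b_def by auto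
  have comp: "(\<Sum>j<k. complex_of_real (S $$ (i, j)) * w $ j) = \<mu> * w $ i" if i: "i < k" for i
  proof -
    have "(map_mat complex_of_real S *\<^sub>v w) $ i = (\<Sum>j<k. complex_of_real (S $$ (i, j)) * w $ j)"
      using S w i by (simp add: scalar_prod_def atLeast0LessThan)
    then show ?thesis using ew i w by simp
  qed
  have Sa: "S *\<^sub>v a = Re \<mu> \<cdot>\<^sub>v a - Im \<mu> \<cdot>\<^sub>v b"
  proof (rule eq_vecI)
    fix i assume "i < dim_vec (Re \<mu> \<cdot>\<^sub>v a - Im \<mu> \<cdot>\<^sub>v b)"
    then have i: "i < k" using b by simp
    have "(S *\<^sub>v a) $ i = (\<Sum>j<k. S $$ (i, j) * Re (w $ j))"
      using S w i by (simp add: scalar_prod_def atLeast0LessThan a_def)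
    also have "\<dots> = Re (\<mu> * w $ i)" unfolding comp[OF i, symmetric] by simp
    finally show "(S *\<^sub>v a) $ i = (Re \<mu> \<cdot>\<^sub>v a - Im \<mu> \<cdot>\<^sub>v b) $ i"
      using i w by (simp add: a_def b_def)
  qed (use S b in simp)
  have Sb: "S *\<^sub>v b = Re \<mu> \<cdot>\<^sub>v b + Im \<mu> \<cdot>\<^sub>v a"
  proof (rule eq_vecI)
    fix i assume "i < dim_vec (Re \<mu> \<cdot>\<^sub>v b + Im \<mu> \<cdot>\<^sub>v a)"
    then have i: "i < k" using a by simp
    have "(S *\<^sub>v b) $ i = (\<Sum>j<k. S $$ (i, j) * Im (w $ j))"
      using S w i by (simp add: scalar_prod_def atLeast0LessThan b_def)
    also have "\<dots> = Im (\<mu> * w $ i)" unfolding comp[OF i, symmetric] by simp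
    finally show "(S *\<^sub>v b) $ i = (Re \<mu> \<cdot>\<^sub>v b + Im \<mu> \<cdot>\<^sub>v a) $ i"
      using i w by (simp add: a_def b_def)
  qed (use S a in simp)
  have nz: "a \<noteq> 0\<^sub>v k \<or> b \<noteq> 0\<^sub>v k"
  proof (rule ccontr)
    assume "\<not> ?thesis"
    then have "a $ i = 0 \<and> b $ i = 0" if "i < k" for i using that by simp
    then have "w = 0\<^sub>v k" using w by (intro eq_vecI) (auto simp: a_def b_def complex_eq_iff)
    with w show False by simp
  qed
  have z: "V (S *\<^sub>v 0\<^sub>v k) = 0" "V (0\<^sub>v k) = 0"
  proof -
    have "M *\<^sub>v 0\<^sub>v k = 0\<^sub>v k" if "M \<in> carrier_mat k k" for M :: "real mat"
      using that by (intro eq_vecI) auto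
    from this[OF S] this[OF Y] show "V (S *\<^sub>v 0\<^sub>v k) = 0" "V (0\<^sub>v k) = 0" unfolding V_def by auto
  qed
  have le: "V (S *\<^sub>v v) \<le> V v" if "v \<in> carrier_vec k" for v
    using dec[OF that] z unfolding V_def by (cases "v = 0\<^sub>v k") auto
  have lt: "V (S *\<^sub>v a) + V (S *\<^sub>v b) < V a + V b"
    using nz le[OF a] le[OF b] dec[OF a] dec[OF b] unfolding V_def by fastforce
  have "V (S *\<^sub>v a) + V (S *\<^sub>v b) = (cmod \<mu>)\<^sup>2 * (V a + V b)"
    unfolding Sa Sb V_def cmod_power2 by (rule quadratic_form_rotation[OF Y a b])
  with lt have "(cmod \<mu>)\<^sup>2 * (V a + V b) < 1 * (V a + V b)" by simp
  moreover have "0 \<le> V a + V b" using pos[OF a] pos[OF b] unfolding V_def by simp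
  ultimately have "(cmod \<mu>)\<^sup>2 < 1" by (metis mult_right_mono not_le)
  then show "cmod \<mu> < 1" by (simp add: power_less_one_iff abs_square_less_1)
qed

lemma pow_mat_smult:
  fixes A :: "'a :: comm_semiring_1 mat"
  assumes A: "A \<in> carrier_mat n n"
  shows "(c \<cdot>\<^sub>m A) ^\<^sub>m t = c ^ t \<cdot>\<^sub>m (A ^\<^sub>m t)"
proof (induction t)
  case 0
  show ?case using A by (intro eq_matI) auto
next
  case (Suc t)
  have "A ^\<^sub>m t \<in> carrier_mat n n" using A by (rule pow_carrier_mat)
  then have "(c ^ t \<cdot>\<^sub>m A ^\<^sub>m t) * (c \<cdot>\<^sub>m A) = (c * c ^ t) \<cdot>\<^sub>m (A ^\<^sub>m t * A)"
    using A by (intro eq_matI) (auto simp: scalar_prod_def sum_distrib_left mult_ac)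
  then show ?case by (simp add: Suc)
qed

lemma schur_stable_spectral_radius:
  assumes S: "S \<in> carrier_mat k k" and st: "schur_stable S" and k: "k > 0"
  shows "spectral_radius (map_mat complex_of_real S) < 1"
proof -
  have "map_mat complex_of_real S \<in> carrier_mat k k" using S by simp
  from spectral_radius_mem_max(1)[OF this k] st show ?thesis
    unfolding schur_stable_def spectrum_def by auto
qed

text \<open>
  The Jordan normal form bounds the powers; decay comes from the room that is left below one: for
  \<open>r < 1\<close> above the spectral radius, \<open>S / r\<close> still has spectral radius below one, so its powers are
  bounded and those of \<open>S\<close> are \<open>O(r\<^sup>t)\<close>.
\<close>

lemma schur_stable_pow_tendsto_zero:
  assumes S: "S \<in> carrier_mat k k" and st: "schur_stable S" and i: "i < k" and j: "j < k"
  shows "(\<lambda>t. (S ^\<^sub>m t) $$ (i, j)) \<longlonglongrightarrow> 0"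
proof -
  define M where "M = map_mat complex_of_real S"
  have M: "M \<in> carrier_mat k k" using S unfolding M_def by simp
  have k: "k > 0" using i by simp
  have sr: "spectral_radius M < 1" unfolding M_def by (rule schur_stable_spectral_radius[OF S st k])
  obtain r where r: "max 0 (spectral_radius M) < r" "r < 1" using sr dense[of "max 0 (spectral_radius M)" 1] by auto
  define N where "N = complex_of_real (1 / r) \<cdot>\<^sub>m M"
  have N: "N \<in> carrier_mat k k" using M unfolding N_def by simp
  have "spectral_radius N < 1"
  proof -
    from spectral_radius_mem_max(1)[OF N k] obtain \<mu> where mu: "spectral_radius N = cmod \<mu>" "eigenvalue N \<mu>"
      unfolding spectrum_def by auto
    then obtain w where w: "w \<in> carrier_vec k" "w \<noteq> 0\<^sub>v k" "N *\<^sub>v w = \<mu> \<cdot>\<^sub>v w"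
      using N unfolding eigenvalue_def eigenvector_def by auto
    have "M *\<^sub>v w = complex_of_real r \<cdot>\<^sub>v (N *\<^sub>v w)"
      using r M w(1) unfolding N_def by (intro eq_vecI) (auto simp: scalar_prod_def sum_distrib_left)
    then have "M *\<^sub>v w = (complex_of_real r * \<mu>) \<cdot>\<^sub>v w" unfolding w(3) by (simp add: smult_smult_assoc)
    then have "eigenvalue M (complex_of_real r * \<mu>)" using w M unfolding eigenvalue_def eigenvector_def by auto
    then have "cmod (complex_of_real r * \<mu>) \<le> spectral_radius M"
      using spectral_radius_mem_max(2)[OF M k] unfolding spectrum_def by auto
    then have "r * cmod \<mu> \<le> spectral_radius M" using r by (simp add: norm_mult)
    then have "r * cmod \<mu> < r * 1" using r by linarith
    then show ?thesis using r mu(1) by (subst (asm) mult_less_cancel_left_pos) auto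
  qed
  from spectral_radius_jnf_norm_bound_less_1_upper_triangular[OF N this]
  obtain c where c: "\<And>t. norm_bound (N ^\<^sub>m t) c" by auto
  have bnd: "\<bar>(S ^\<^sub>m t) $$ (i, j)\<bar> \<le> c * r ^ t" for t
  proof -
    have St: "S ^\<^sub>m t \<in> carrier_mat k k" by (rule pow_carrier_mat[OF S])
    have "M ^\<^sub>m t = map_mat complex_of_real (S ^\<^sub>m t)" unfolding M_def
      by (rule of_real_hom.mat_hom_pow[OF S, symmetric])
    then have "N ^\<^sub>m t = complex_of_real (1 / r) ^ t \<cdot>\<^sub>m map_mat complex_of_real (S ^\<^sub>m t)"
      unfolding N_def pow_mat_smult[OF M] by simp
    moreover have "cmod ((N ^\<^sub>m t) $$ (i, j)) \<le> c"
      using c[of t] i j carrier_matD[OF pow_carrier_mat[OF N, of t]] unfolding norm_bound_def by metis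
    ultimately have "cmod (complex_of_real ((1 / r) ^ t * (S ^\<^sub>m t) $$ (i, j))) \<le> c"
      using i j carrier_matD[OF St] by simp
    then have "(1 / r) ^ t * \<bar>(S ^\<^sub>m t) $$ (i, j)\<bar> \<le> c"
      unfolding norm_of_real using r by (simp add: abs_mult)
    then show ?thesis using r by (simp add: field_simps power_divide)
  qed
  have "(\<lambda>t. c * r ^ t) \<longlonglongrightarrow> 0" using r by (intro tendsto_mult_right_zero LIMSEQ_realpow_zero) auto
  then show ?thesis by (rule Lim_null_comparison[rotated]) (simp add: bnd)
qed

lemma schur_stable_recursion_tendsto_zero:
  assumes S: "S \<in> carrier_mat k k" and st: "schur_stable S"
    and e: "\<And>t. e t \<in> carrier_vec k" and rec: "\<And>t. e (Suc t) = S *\<^sub>v e t" and i: "i < k"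
  shows "(\<lambda>t. e t $ i) \<longlonglongrightarrow> 0"
proof -
  have St: "S ^\<^sub>m t \<in> carrier_mat k k" for t by (rule pow_carrier_mat[OF S])
  have "e t = S ^\<^sub>m t *\<^sub>v e 0" for t
  proof (induction t)
    case 0
    show ?case using e S by simp
  next
    case (Suc t)
    have "S * S ^\<^sub>m t = S ^\<^sub>m t * S"
    proof (induction t)
      case 0
      show ?case using S by simp
    next
      case (Suc t)
      have "S * (S ^\<^sub>m t * S) = (S * S ^\<^sub>m t) * S" using S St by (simp add: assoc_mult_mat[of _ k k _ k _ k])
      then show ?case unfolding pow_mat.simps Suc .
    qed
    then show ?case unfolding rec Suc.IH pow_mat.simps
      using assoc_mult_mat_vec[OF S St e] by metis
  qed
  then have "e t $ i = (S ^\<^sub>m t *\<^sub>v e 0) $ i" for t by metis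
  then have sum: "(\<lambda>t. e t $ i) = (\<lambda>t. \<Sum>j<k. (S ^\<^sub>m t) $$ (i, j) * e 0 $ j)"
    using i carrier_matD[OF St] carrier_vecD[OF e[of 0]] by (simp add: scalar_prod_def atLeast0LessThan)
  show ?thesis unfolding sum using schur_stable_pow_tendsto_zero[OF S st i]
    by (intro tendsto_null_sum tendsto_mult_left_zero) simp
qed

section \<open>Scalar products, zero matrices and inverses\<close>

lemma scalar_prod_self_eq_0:
  fixes v :: "real vec"
  assumes "v \<in> carrier_vec n" shows "v \<bullet> v = 0 \<longleftrightarrow> v = 0\<^sub>v n"
proof -
  have "v \<bullet> v = (\<Sum>i<n. v $ i * v $ i)" using assms by (simp add: scalar_prod_def atLeast0LessThan)
  also have "\<dots> = 0 \<longleftrightarrow> (\<forall>i<n. v $ i = 0)" by (subst sum_nonneg_eq_0_iff) auto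
  also have "\<dots> \<longleftrightarrow> v = 0\<^sub>v n" using assms by (auto intro: eq_vecI)
  finally show ?thesis .
qed

lemma scalar_prod_self_nonneg:
  fixes v :: "real vec"
  shows "0 \<le> v \<bullet> v"
  by (simp add: scalar_prod_def sum_nonneg)

lemma transpose_scalar_prod:
  fixes M :: "'a :: comm_semiring_0 mat"
  assumes M: "M \<in> carrier_mat k n" and v: "v \<in> carrier_vec n" and w: "w \<in> carrier_vec k"
  shows "v \<bullet> (M\<^sup>T *\<^sub>v w) = (M *\<^sub>v v) \<bullet> w"
proof -
  have "v \<bullet> (M\<^sup>T *\<^sub>v w) = (M\<^sup>T *\<^sub>v w) \<bullet> v" using M v w by (intro comm_scalar_prod) auto
  also have "\<dots> = w \<bullet> (M *\<^sub>v v)" using transpose_vec_mult_scalar[OF M v w] .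
  also have "\<dots> = (M *\<^sub>v v) \<bullet> w" using M v w by (intro comm_scalar_prod) auto
  finally show ?thesis .
qed

lemma zero_mat_mult_vec:
  "v \<in> carrier_vec c \<Longrightarrow> (0\<^sub>m r c :: 'a :: semiring_0 mat) *\<^sub>v v = 0\<^sub>v r"
  by (intro eq_vecI) auto

lemma mat_mult_zero_vec:
  "M \<in> carrier_mat r c \<Longrightarrow> (M :: 'a :: semiring_0 mat) *\<^sub>v 0\<^sub>v c = 0\<^sub>v r"
  by (intro eq_vecI) auto

lemma minus_zero_mat:
  "M \<in> carrier_mat r c \<Longrightarrow> (M :: 'a :: group_add mat) - 0\<^sub>m r c = M"
  by (intro eq_matI) auto

lemma mat_inv_invertible:
  assumes A: "A \<in> carrier_mat n n" and inv: "B * A = 1\<^sub>m n" and B: "B \<in> carrier_mat n n"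
  shows "mat_inv A \<in> carrier_mat n n" "A * mat_inv A = 1\<^sub>m n" "mat_inv A * A = 1\<^sub>m n"
proof -
  have "A * B = 1\<^sub>m n" by (rule mat_mult_left_right_inverse[OF B A inv])
  then have "A \<in> Units (ring_mat TYPE('a) n ())" unfolding Units_def ring_mat_def using A B inv by auto
  then obtain R where "mat_inverse A = Some R" using mat_inverse(1)[OF A, of "()"] by (cases "mat_inverse A") auto
  then show "mat_inv A \<in> carrier_mat n n" "A * mat_inv A = 1\<^sub>m n" "mat_inv A * A = 1\<^sub>m n"
    using mat_inverse(2)[OF A] unfolding mat_inv_def by auto
qed

lemma mat_inv_trivial_kernel:
  fixes A :: "'a :: field mat"
  assumes A: "A \<in> carrier_mat n n" and ker: "\<And>v. v \<in> carrier_vec n \<Longrightarrow> A *\<^sub>v v = 0\<^sub>v n \<Longrightarrow> v = 0\<^sub>v n"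
  shows "mat_inv A \<in> carrier_mat n n" "A * mat_inv A = 1\<^sub>m n" "mat_inv A * A = 1\<^sub>m n"
proof -
  have "det A \<noteq> 0" using det_0_iff_vec_prod_zero_field[OF A] ker by auto
  then have "A \<in> Units (ring_mat TYPE('a) n ())" by (rule det_non_zero_imp_unit[OF A])
  then obtain B where "B * A = 1\<^sub>m n" "B \<in> carrier_mat n n" unfolding Units_def ring_mat_def by auto
  from mat_inv_invertible[OF A this]
  show "mat_inv A \<in> carrier_mat n n" "A * mat_inv A = 1\<^sub>m n" "mat_inv A * A = 1\<^sub>m n" .
qed

section \<open>Products of block matrices\<close>

lemma append_cols_carrier [simp]:
  "A \<in> carrier_mat r a \<Longrightarrow> B \<in> carrier_mat r b \<Longrightarrow> A @\<^sub>c B \<in> carrier_mat r (a + b)"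
  unfolding append_cols_def by auto

lemma append_cols_mult_append_rows:
  fixes A :: "'a :: comm_ring_1 mat"
  assumes A: "A \<in> carrier_mat r a" and B: "B \<in> carrier_mat r b"
    and U: "U \<in> carrier_mat a c" and V: "V \<in> carrier_mat b c"
  shows "(A @\<^sub>c B) * (U @\<^sub>r V) = A * U + B * V"
proof -
  have "(A @\<^sub>c B) * (U @\<^sub>r V) = four_block_mat (A * U + B * V) (A * 0\<^sub>m a 0 + B * 0\<^sub>m b 0)
      (0\<^sub>m 0 a * U + 0\<^sub>m 0 b * V) (0\<^sub>m 0 a * 0\<^sub>m a 0 + 0\<^sub>m 0 b * 0\<^sub>m b 0)"
    unfolding append_cols_def append_rows_def using A B U V
    by (subst mult_four_block_mat[of _ r a _ b _ 0 _ _ c _ 0]) auto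
  also have "\<dots> = A * U + B * V" using A B U V by (intro eq_matI) auto
  finally show ?thesis .
qed

lemma append_rows_mult_append_cols:
  fixes U :: "'a :: comm_ring_1 mat"
  assumes U: "U \<in> carrier_mat a c" and V: "V \<in> carrier_mat b c"
    and W: "W \<in> carrier_mat c d" and Z: "Z \<in> carrier_mat c e"
  shows "(U @\<^sub>r V) * (W @\<^sub>c Z) = four_block_mat (U * W) (U * Z) (V * W) (V * Z)"
proof -
  have "(U @\<^sub>r V) * (W @\<^sub>c Z) = four_block_mat (U * W + 0\<^sub>m a 0 * 0\<^sub>m 0 d) (U * Z + 0\<^sub>m a 0 * 0\<^sub>m 0 e)
      (V * W + 0\<^sub>m b 0 * 0\<^sub>m 0 d) (V * Z + 0\<^sub>m b 0 * 0\<^sub>m 0 e)"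
    unfolding append_cols_def append_rows_def using U V W Z
    by (subst mult_four_block_mat[of _ a c _ 0 _ b _ _ d _ e]) auto
  also have "\<dots> = four_block_mat (U * W) (U * Z) (V * W) (V * Z)" using U V W Z by simp
  finally show ?thesis .
qed

section \<open>Data matrices of full row rank\<close>

text \<open>
  A maximal independent set of columns has \<open>N\<close> elements and forms an invertible matrix, whose
  transpose maps \<open>r\<close> to zero.
\<close>

lemma full_row_rank_left_kernel:
  fixes M :: "'a :: field mat"
  assumes M: "M \<in> carrier_mat N nc" and rank: "vec_space.rank N M = N"
    and r: "r \<in> carrier_vec N" and orth: "\<And>j. j < nc \<Longrightarrow> r \<bullet> col M j = 0"
  shows "r = 0\<^sub>v N"
proof -
  interpret vec_space "TYPE('a)" N .
  have "\<exists>S. finite S \<and> maximal S (\<lambda>S. S \<subseteq> set (cols M) \<and> lin_indpt S) \<and> {} \<subseteq> S"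
    by (rule maximal_exists_superset[of "set (cols M)"]) (auto simp: lin_dep_def)
  then obtain S where fin: "finite S" and max: "maximal S (\<lambda>S. S \<subseteq> set (cols M) \<and> lin_indpt S)" by blast
  have S: "S \<subseteq> set (cols M)" "lin_indpt S" using max unfolding maximal_def by auto
  have card: "card S = N" using rank_card_indpt[OF M max] rank by simp
  obtain vs where vs: "set vs = S" "distinct vs" using finite_distinct_list[OF fin] by blast
  have len: "length vs = N" using vs card distinct_card by fastforce
  have vsc: "set vs \<subseteq> carrier_vec N" using vs S cols_dim[of M] M by auto
  define B where "B = mat_of_cols N vs"
  have B: "B \<in> carrier_mat N N" unfolding B_def using len by auto
  have colsB: "cols B = vs" unfolding B_def using vsc by (rule cols_mat_of_cols)
  have "rank B = N" using lin_indpt_full_rank[OF B] colsB vs S by simp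
  then have "det (B\<^sup>T) \<noteq> 0" using det_rank_iff[OF B] det_transpose[OF B] by simp
  moreover have "B\<^sup>T *\<^sub>v r = 0\<^sub>v N"
  proof (rule eq_vecI)
    fix i assume "i < dim_vec (0\<^sub>v N :: 'a vec)"
    then have i: "i < N" by simp
    have "col B i \<in> set (cols M)" using i B colsB vs S cols_nth[of i B] len nth_mem[of i vs] by auto
    then obtain j where "j < nc" "col B i = col M j" using M by (auto simp: cols_def)
    then have "r \<bullet> col B i = 0" using orth by simp
    then show "(B\<^sup>T *\<^sub>v r) $ i = 0\<^sub>v N $ i"
      using i B r comm_scalar_prod[OF r, of "col B i"] by simp
  qed (use B in simp)
  ultimately show ?thesis
    using det_0_iff_vec_prod_zero_field[of "B\<^sup>T" N] B r by auto
qed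

lemma past_mat_carrier: "past_mat T k w \<in> carrier_mat k (T - 1)"
  unfolding past_mat_def by (rule carrier_matI) auto

lemma future_mat_carrier: "future_mat T k w \<in> carrier_mat k (T - 1)"
  unfolding future_mat_def by (rule carrier_matI) auto

text \<open>The simplifier turns \<open>T - 1\<close> into \<open>T - Suc 0\<close>, hence the simplified variants.\<close>

declare past_mat_carrier [simplified, simp] future_mat_carrier [simplified, simp]

lemma col_past_mat: "t < T - 1 \<Longrightarrow> w t \<in> carrier_vec k \<Longrightarrow> col (past_mat T k w) t = w t"
  unfolding past_mat_def by (subst col_mat_of_cols) auto

lemma col_future_mat: "t < T - 1 \<Longrightarrow> w (Suc t) \<in> carrier_vec k \<Longrightarrow> col (future_mat T k w) t = w (Suc t)"
  unfolding future_mat_def by (subst col_mat_of_cols) auto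

lemma vec_first_carrier [simp]: "vec_first v k \<in> carrier_vec k"
  unfolding vec_first_def by simp

lemma data_solution_iff:
  assumes u: "\<And>t. t < T - 1 \<Longrightarrow> u t \<in> carrier_vec m" and y: "\<And>t. t < T \<Longrightarrow> y t \<in> carrier_vec p"
    and S: "S1 \<in> carrier_mat (n - p) m" "S2 \<in> carrier_mat (n - p) p"
      "S3 \<in> carrier_mat (n - p) p" "S4 \<in> carrier_mat (n - p) (n - p)"
  shows "data_solution T n m p u y x S1 S2 S3 S4 \<longleftrightarrow>
    (\<forall>t<T - 1. vec_first (x (Suc t)) (n - p) =
       S1 *\<^sub>v u t + (S2 *\<^sub>v y t + (S3 *\<^sub>v y (Suc t) + S4 *\<^sub>v vec_first (x t) (n - p))))"
proof -
  define k N where "k = n - p" and "N = T - 1"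
  define Up Yp Yf Xp Xf where "Up = past_mat T m u" and "Yp = past_mat T p y" and "Yf = future_mat T p y"
    and "Xp = past_mat T k (\<lambda>t. vec_first (x t) k)" and "Xf = future_mat T k (\<lambda>t. vec_first (x t) k)"
  note defs = Up_def Yp_def Yf_def Xp_def Xf_def
  note S = S[folded k_def]
  have D [simp]: "Up \<in> carrier_mat m N" "Yp \<in> carrier_mat p N" "Yf \<in> carrier_mat p N"
    "Xp \<in> carrier_mat k N" "Xf \<in> carrier_mat k N" unfolding defs N_def by simp_all
  have prod: "(S1 @\<^sub>c S2 @\<^sub>c S3 @\<^sub>c S4) * (Up @\<^sub>r Yp @\<^sub>r Yf @\<^sub>r Xp) = S1 * Up + (S2 * Yp + (S3 * Yf + S4 * Xp))"
    using S append_cols_mult_append_rows[of S1 k m "S2 @\<^sub>c S3 @\<^sub>c S4" "p + (p + k)" Up N "Yp @\<^sub>r Yf @\<^sub>r Xp"]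
      append_cols_mult_append_rows[of S2 k p "S3 @\<^sub>c S4" "p + k" Yp N "Yf @\<^sub>r Xp"]
      append_cols_mult_append_rows[of S3 k p S4 k Yf N Xp]
    by simp
  have colX: "col Xf t = vec_first (x (Suc t)) k" if "t < N" for t
    using that unfolding Xf_def N_def by (simp add: col_future_mat)
  have colS: "col (S1 * Up + (S2 * Yp + (S3 * Yf + S4 * Xp))) t =
      S1 *\<^sub>v u t + (S2 *\<^sub>v y t + (S3 *\<^sub>v y (Suc t) + S4 *\<^sub>v vec_first (x t) k))" if t: "t < N" for t
  proof -
    have c: "col Up t = u t" "col Yp t = y t" "col Yf t = y (Suc t)" "col Xp t = vec_first (x t) k"
      using t u y unfolding defs N_def by (auto simp: col_past_mat col_future_mat)
    have "col (S1 * Up + (S2 * Yp + (S3 * Yf + S4 * Xp))) t =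
        S1 *\<^sub>v col Up t + (S2 *\<^sub>v col Yp t + (S3 *\<^sub>v col Yf t + S4 *\<^sub>v col Xp t))"
      using S t by (simp add: col_add[of _ k N] col_mult2[of _ k _ _ N] add_carrier_mat)
    then show ?thesis unfolding c .
  qed
  have "Xf = S1 * Up + (S2 * Yp + (S3 * Yf + S4 * Xp)) \<longleftrightarrow>
      (\<forall>t<N. col Xf t = col (S1 * Up + (S2 * Yp + (S3 * Yf + S4 * Xp))) t)" (is "?l = ?r")
  proof
    assume ?r
    then show ?l using S carrier_matD[OF D(4)] carrier_matD[OF D(5)] by (intro mat_col_eqI) auto
  qed simp
  then show ?thesis
    unfolding data_solution_def N_def[symmetric] k_def[symmetric] defs[symmetric] prod using S colX colS by auto
qed

text \<open>
  Full row rank means that no nontrivial linear functional of \<open>(u, d, x)\<close> vanishes at all samples.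
\<close>

lemma full_row_rank_samples:
  assumes u: "\<And>t. t < T - 1 \<Longrightarrow> u t \<in> carrier_vec m" and d: "\<And>t. t < T - 1 \<Longrightarrow> d t \<in> carrier_vec q"
    and x: "\<And>t. t < T - 1 \<Longrightarrow> x t \<in> carrier_vec n"
    and rank: "vec_space.rank (m + q + n) (past_mat T m u @\<^sub>r past_mat T q d @\<^sub>r past_mat T n x) = m + q + n"
    and a: "a \<in> carrier_vec m" and b: "b \<in> carrier_vec q" and c: "c \<in> carrier_vec n"
    and orth: "\<And>t. t < T - 1 \<Longrightarrow> a \<bullet> u t + b \<bullet> d t + c \<bullet> x t = 0"
  shows "a = 0\<^sub>v m" "b = 0\<^sub>v q" "c = 0\<^sub>v n"
proof -
  let ?M = "past_mat T m u @\<^sub>r past_mat T q d @\<^sub>r past_mat T n x"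
  let ?r = "a @\<^sub>v (b @\<^sub>v c)"
  have M: "?M \<in> carrier_mat (m + q + n) (T - 1)"
    using carrier_append_rows[OF past_mat_carrier carrier_append_rows[OF past_mat_carrier past_mat_carrier]]
    by (simp add: add.assoc)
  have Q: "past_mat T q d @\<^sub>r past_mat T n x \<in> carrier_mat (q + n) (T - 1)"
    by (rule carrier_append_rows[OF past_mat_carrier past_mat_carrier])
  have r: "?r \<in> carrier_vec (m + q + n)" using a b c by (simp add: add.assoc)
  have "?r \<bullet> col ?M t = 0" if t: "t < T - 1" for t
  proof -
    have 1: "col (past_mat T q d @\<^sub>r past_mat T n x) t = d t @\<^sub>v x t"
      unfolding append_rows_def using t d[OF t] x[OF t] carrier_matD[OF past_mat_carrier]
      by (subst col_four_block_mat[of _ q "T - 1" _ 0 _ n]) (auto simp: col_past_mat)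
    have "col ?M t = u t @\<^sub>v col (past_mat T q d @\<^sub>r past_mat T n x) t"
      unfolding append_rows_def[of "past_mat T m u"]
      using t u[OF t] Q carrier_matD[OF Q] carrier_matD[OF past_mat_carrier]
      by (subst col_four_block_mat[of _ m "T - 1" _ 0 _ "q + n"]) (auto simp: col_past_mat)
    then have "col ?M t = u t @\<^sub>v (d t @\<^sub>v x t)" unfolding 1 .
    then show ?thesis using a b c u[OF t] d[OF t] x[OF t] orth[OF t]
      by (simp add: scalar_prod_append[of _ m _ "q + n"] scalar_prod_append[of _ q _ n])
  qed
  from full_row_rank_left_kernel[OF M rank r this]
  have 0: "?r = 0\<^sub>v (m + q + n)" .
  have z: "?r $ i = 0" if "i < m + q + n" for i unfolding 0 using that by simp
  show "a = 0\<^sub>v m"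
  proof (rule eq_vecI)
    fix i assume "i < dim_vec (0\<^sub>v m :: real vec)"
    then show "a $ i = 0\<^sub>v m $ i" using z[of i] a by simp
  qed (use a in simp)
  show "b = 0\<^sub>v q"
  proof (rule eq_vecI)
    fix i assume "i < dim_vec (0\<^sub>v q :: real vec)"
    then show "b $ i = 0\<^sub>v q $ i" using z[of "m + i"] a b by simp
  qed (use b in simp)
  show "c = 0\<^sub>v n"
  proof (rule eq_vecI)
    fix i assume "i < dim_vec (0\<^sub>v n :: real vec)"
    then show "c $ i = 0\<^sub>v n $ i" using z[of "m + q + i"] a b c by simp
  qed (use c in simp)
qed

lemma full_row_rank_samples_mat:
  assumes u: "\<And>t. t < T - 1 \<Longrightarrow> u t \<in> carrier_vec m" and d: "\<And>t. t < T - 1 \<Longrightarrow> d t \<in> carrier_vec q"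
    and x: "\<And>t. t < T - 1 \<Longrightarrow> x t \<in> carrier_vec n"
    and rank: "vec_space.rank (m + q + n) (past_mat T m u @\<^sub>r past_mat T q d @\<^sub>r past_mat T n x) = m + q + n"
    and M: "M1 \<in> carrier_mat k m" "M2 \<in> carrier_mat k q" "M3 \<in> carrier_mat k n"
    and zero: "\<And>t. t < T - 1 \<Longrightarrow> M1 *\<^sub>v u t + M2 *\<^sub>v d t + M3 *\<^sub>v x t = 0\<^sub>v k"
  shows "M1 = 0\<^sub>m k m" "M2 = 0\<^sub>m k q" "M3 = 0\<^sub>m k n"
proof -
  have rows: "row M1 i = 0\<^sub>v m" "row M2 i = 0\<^sub>v q" "row M3 i = 0\<^sub>v n" if i: "i < k" for i
  proof -
    have "row M1 i \<bullet> u t + row M2 i \<bullet> d t + row M3 i \<bullet> x t = 0" if t: "t < T - 1" for t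
    proof -
      have "(M1 *\<^sub>v u t + M2 *\<^sub>v d t + M3 *\<^sub>v x t) $ i = 0" unfolding zero[OF t] using i by simp
      then show ?thesis using i M by simp
    qed
    moreover have "row M1 i \<in> carrier_vec m" "row M2 i \<in> carrier_vec q" "row M3 i \<in> carrier_vec n"
      using M by (auto intro!: carrier_vecI)
    ultimately show "row M1 i = 0\<^sub>v m" "row M2 i = 0\<^sub>v q" "row M3 i = 0\<^sub>v n"
      using full_row_rank_samples[OF u d x rank] by blast+
  qed
  show "M1 = 0\<^sub>m k m" "M2 = 0\<^sub>m k q" "M3 = 0\<^sub>m k n"
    using M rows by (auto intro!: eq_rowI)
qed

text \<open>
  Since \<open>Y = C X\<close>, only the invertibility of \<open>X X\<^sup>T\<close> is at stake.  If \<open>X X\<^sup>T v = 0\<close> then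
  \<open>|X\<^sup>T v|\<^sup>2 = 0\<close>, so \<open>v\<close> is orthogonal to all state samples.
\<close>

lemma output_matrix_from_data:
  assumes u: "\<And>t. t < T - 1 \<Longrightarrow> u t \<in> carrier_vec m" and d: "\<And>t. t < T - 1 \<Longrightarrow> d t \<in> carrier_vec q"
    and x: "\<And>t. t < T - 1 \<Longrightarrow> x t \<in> carrier_vec n" and C: "C \<in> carrier_mat p n"
    and y: "\<And>t. t < T - 1 \<Longrightarrow> y t = C *\<^sub>v x t"
    and rank: "vec_space.rank (m + q + n) (past_mat T m u @\<^sub>r past_mat T q d @\<^sub>r past_mat T n x) = m + q + n"
  shows "C = past_mat T p y * (past_mat T n x)\<^sup>T * mat_inv (past_mat T n x * (past_mat T n x)\<^sup>T)"
proof -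
  define X where "X = past_mat T n x"
  have X: "X \<in> carrier_mat n (T - 1)" unfolding X_def by (rule past_mat_carrier)
  have XT: "X\<^sup>T \<in> carrier_mat (T - 1) n" using X by simp
  have XX: "X * X\<^sup>T \<in> carrier_mat n n" using X by simp
  have "past_mat T p y = C * X"
  proof (rule mat_col_eqI)
    fix t assume "t < dim_col (C * X)"
    then have t: "t < T - 1" using carrier_matD[OF X] by simp
    then show "col (past_mat T p y) t = col (C * X) t"
      using col_mult2[OF C X t] x[OF t] y[OF t] C unfolding X_def by (simp add: col_past_mat)
  qed (use C carrier_matD[OF X] carrier_matD[OF past_mat_carrier] in simp_all)
  then have "past_mat T p y * X\<^sup>T = C * (X * X\<^sup>T)" using assoc_mult_mat[OF C X XT] by simp
  moreover have "v = 0\<^sub>v n" if v: "v \<in> carrier_vec n" and ker: "X * X\<^sup>T *\<^sub>v v = 0\<^sub>v n" for v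
  proof -
    have XTv: "X\<^sup>T *\<^sub>v v \<in> carrier_vec (T - 1)" using XT v by (rule mult_mat_vec_carrier)
    have "X *\<^sub>v (X\<^sup>T *\<^sub>v v) = 0\<^sub>v n" using ker assoc_mult_mat_vec[OF X XT v] by simp
    then have "(X\<^sup>T *\<^sub>v v) \<bullet> (X\<^sup>T *\<^sub>v v) = 0"
      using transpose_scalar_prod[OF XT v XTv] v by simp
    then have 0: "X\<^sup>T *\<^sub>v v = 0\<^sub>v (T - 1)" using scalar_prod_self_eq_0[OF XTv] by simp
    have "0\<^sub>v m \<bullet> u t + 0\<^sub>v q \<bullet> d t + v \<bullet> x t = 0" if t: "t < T - 1" for t
    proof -
      have "(X\<^sup>T *\<^sub>v v) $ t = 0" unfolding 0 using t by simp
      then have "col X t \<bullet> v = 0" using t carrier_matD[OF X] by simp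
      then show ?thesis using u[OF t] d[OF t] x[OF t] t v comm_scalar_prod[OF v x[OF t]] unfolding X_def by (simp add: col_past_mat)
    qed
    from full_row_rank_samples(3)[OF u d x rank _ _ v this] show ?thesis by simp
  qed
  from mat_inv_trivial_kernel(1,2)[OF XX this] assoc_mult_mat[OF C XX, of "mat_inv (X * X\<^sup>T)" n]
  have "C * (X * X\<^sup>T) * mat_inv (X * X\<^sup>T) = C" using C by simp
  ultimately show ?thesis unfolding X_def by simp
qed

section \<open>Coordinates adapted to the output\<close>

text \<open>
  The matrices \<open>P\<close> and \<open>C\<close> stacked on each other are invertible, and \<open>L\<close> and \<open>K\<close> are the two column
  blocks of the inverse.  The columns of \<open>L\<close> are a basis of the kernel of \<open>C\<close>.
\<close>

locale output_coordinates =
  fixes n k p :: nat and P L K C :: "real mat"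
  assumes P: "P \<in> carrier_mat k n" and L: "L \<in> carrier_mat n k"
    and K: "K \<in> carrier_mat n p" and C: "C \<in> carrier_mat p n"
    and PL: "P * L = 1\<^sub>m k" and CL: "C * L = 0\<^sub>m p k"
    and sum: "L * P + K * C = 1\<^sub>m n"

context output_coordinates
begin

text \<open>
  Applied to \<open>P - F\<close>, this turns \<open>F L = 1\<close> into \<open>F = P - D C\<close> with \<open>D = (P - F) K\<close>, which is the form
  that the observer output prescribes.
\<close>

lemma eq_if_vanishing_on_kernel:
  assumes G: "G \<in> carrier_mat r n" and GL: "G * L = 0\<^sub>m r k"
  shows "G = G * K * C"
proof -
  have "G = G * (L * P + K * C)" using G by (simp add: sum)
  also have "\<dots> = G * L * P + G * K * C"
    using mult_add_distrib_mat[OF G mult_carrier_mat[OF L P] mult_carrier_mat[OF K C]]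
      assoc_mult_mat[OF G L P] assoc_mult_mat[OF G K C] by simp
  also have "\<dots> = G * K * C" using G P K C unfolding GL by simp
  finally show ?thesis .
qed

lemma decompose_vec:
  assumes x: "x \<in> carrier_vec n"
  shows "L *\<^sub>v (P *\<^sub>v x) + K *\<^sub>v (C *\<^sub>v x) = x"
proof -
  have "L *\<^sub>v (P *\<^sub>v x) + K *\<^sub>v (C *\<^sub>v x) = (L * P + K * C) *\<^sub>v x"
    using x P L K C by (simp add: add_mult_distrib_mat_vec[of _ n n] assoc_mult_mat_vec[of _ n k _ n] assoc_mult_mat_vec[of _ n p _ n])
  then show ?thesis using x by (simp add: sum)
qed

end

text \<open>
  The product of the stacked rows \<open>P\<close>, \<open>C\<close> and the joined columns \<open>L\<close>, \<open>K\<close> is easily computed to be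
  the identity.  Both factors are square, so the product in the opposite order, which is \<open>L P + K C\<close>,
  is the identity as well.
\<close>

lemma output_coordinates_split:
  assumes C1: "C1 \<in> carrier_mat p k" and C2: "C2 \<in> carrier_mat p p" "invertible_mat C2"
  shows "output_coordinates (k + p) k p (1\<^sub>m k @\<^sub>c 0\<^sub>m k p)
    (1\<^sub>m k @\<^sub>r (- (mat_inv C2 * C1))) (0\<^sub>m k p @\<^sub>r mat_inv C2) (C1 @\<^sub>c C2)"
    and "mat_inv C2 \<in> carrier_mat p p"
proof -
  obtain J0 where "inverts_mat J0 C2" "inverts_mat C2 J0" using C2 unfolding invertible_mat_def by blast
  then have "J0 * C2 = 1\<^sub>m p" "J0 \<in> carrier_mat p p" using C2(1) unfolding inverts_mat_def
    by (metis carrier_matD(1) carrier_matD(2) carrier_matI index_mult_mat(2,3) index_one_mat(2,3))+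
  note J = mat_inv_invertible(1,2)[OF C2(1) this]
  then show "mat_inv C2 \<in> carrier_mat p p" by simp
  define J where "J = mat_inv C2"
  note J = J[folded J_def]
  define P L K where "P = (1\<^sub>m k :: real mat) @\<^sub>c 0\<^sub>m k p" and "L = 1\<^sub>m k @\<^sub>r (- (J * C1))" and "K = 0\<^sub>m k p @\<^sub>r J"
  have W: "- (J * C1) \<in> carrier_mat p k" using J C1 by simp
  have P: "P \<in> carrier_mat k (k + p)" and L: "L \<in> carrier_mat (k + p) k" and K: "K \<in> carrier_mat (k + p) p"
    and C: "C1 @\<^sub>c C2 \<in> carrier_mat p (k + p)"
    unfolding P_def L_def K_def using W J C1 C2 by simp_all
  have PL: "P * L = 1\<^sub>m k" unfolding P_def L_def
    using append_cols_mult_append_rows[of "1\<^sub>m k" k k "0\<^sub>m k p" p "1\<^sub>m k" k, OF _ _ _ W] left_mult_zero_mat[OF W, of k] by simp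
  have PK: "P * K = 0\<^sub>m k p" unfolding P_def K_def
    using append_cols_mult_append_rows[of "1\<^sub>m k" k k "0\<^sub>m k p" p "0\<^sub>m k p" p, OF _ _ _ J(1)] J by simp
  have CK: "(C1 @\<^sub>c C2) * K = 1\<^sub>m p" unfolding K_def
    using append_cols_mult_append_rows[OF C1 C2(1) _ J(1), of "0\<^sub>m k p"] J C1 by simp
  have "(C1 @\<^sub>c C2) * L = C1 * 1\<^sub>m k + C2 * (- (J * C1))" unfolding L_def
    by (rule append_cols_mult_append_rows[OF C1 C2(1) _ W]) simp
  also have "C2 * (- (J * C1)) = - (C2 * J * C1)"
    using C1 C2(1) J(1) by (simp add: assoc_mult_mat[of _ p p _ p _ k])
  also have "\<dots> = - C1" using C1 by (simp add: J)
  also have "C1 * 1\<^sub>m k + - C1 = 0\<^sub>m p k" using C1 by (intro eq_matI) auto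
  finally have CL: "(C1 @\<^sub>c C2) * L = 0\<^sub>m p k" .
  have "(P @\<^sub>r (C1 @\<^sub>c C2)) * (L @\<^sub>c K) = 1\<^sub>m (k + p)"
    unfolding append_rows_mult_append_cols[OF P C L K] PL PK CL CK by simp
  then have "(L @\<^sub>c K) * (P @\<^sub>r (C1 @\<^sub>c C2)) = 1\<^sub>m (k + p)"
    by (rule mat_mult_left_right_inverse[rotated -1]) (use P L K C in simp_all)
  then have "L * P + K * (C1 @\<^sub>c C2) = 1\<^sub>m (k + p)"
    unfolding append_cols_mult_append_rows[OF L K P C] .
  with P L K C PL CL show "output_coordinates (k + p) k p (1\<^sub>m k @\<^sub>c 0\<^sub>m k p)
    (1\<^sub>m k @\<^sub>r (- (mat_inv C2 * C1))) (0\<^sub>m k p @\<^sub>r mat_inv C2) (C1 @\<^sub>c C2)"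
    unfolding output_coordinates_def P_def L_def K_def J_def by blast
qed

lemma head_mult_vec:
  assumes "x \<in> carrier_vec (k + p)"
  shows "(1\<^sub>m k @\<^sub>c 0\<^sub>m k p :: real mat) *\<^sub>v x = vec_first x k"
proof (rule eq_vecI)
  fix i assume "i < dim_vec (vec_first x k)"
  then have i: "i < k" by (simp add: vec_first_def)
  have "row (1\<^sub>m k @\<^sub>c 0\<^sub>m k p :: real mat) i = unit_vec (k + p) i"
    unfolding append_cols_def using i by (intro eq_vecI) auto
  then show "((1\<^sub>m k @\<^sub>c 0\<^sub>m k p :: real mat) *\<^sub>v x) $ i = vec_first x k $ i"
    using i assms by (simp add: append_cols_def vec_first_def)
qed (simp add: vec_first_def append_cols_def)

lemma observer_estimate_eq:
  assumes C1: "C1 \<in> carrier_mat p k" and J: "mat_inv C2 \<in> carrier_mat p p" and D: "DU \<in> carrier_mat k p"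
    and z: "z \<in> carrier_vec k" and y: "y \<in> carrier_vec p"
  shows "observer_estimate C1 C2 DU z y =
    (1\<^sub>m k @\<^sub>r (- (mat_inv C2 * C1))) *\<^sub>v (z + DU *\<^sub>v y) + (0\<^sub>m k p @\<^sub>r mat_inv C2) *\<^sub>v y"
proof -
  let ?G = "mat_inv C2 * C1" and ?J = "mat_inv C2"
  have G: "?G \<in> carrier_mat p k" using J C1 by simp
  have Dy: "DU *\<^sub>v y \<in> carrier_vec k" using D y by simp
  have w: "z + DU *\<^sub>v y \<in> carrier_vec k" using z Dy by simp
  have "(0\<^sub>m k p :: real mat) *\<^sub>v y = 0\<^sub>v k" using y by (intro eq_vecI) auto
  then have "(1\<^sub>m k @\<^sub>r (- ?G)) *\<^sub>v (z + DU *\<^sub>v y) + (0\<^sub>m k p @\<^sub>r ?J) *\<^sub>v y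
      = ((z + DU *\<^sub>v y) @\<^sub>v ((- ?G) *\<^sub>v (z + DU *\<^sub>v y))) + (0\<^sub>v k @\<^sub>v (?J *\<^sub>v y))"
    using mat_mult_append[of "1\<^sub>m k" k k "- ?G" p "z + DU *\<^sub>v y"] mat_mult_append[of "0\<^sub>m k p" k p ?J p y] G J w y
    by simp
  also have "\<dots> = (z + DU *\<^sub>v y + 0\<^sub>v k) @\<^sub>v ((- ?G) *\<^sub>v (z + DU *\<^sub>v y) + ?J *\<^sub>v y)"
    by (rule append_vec_add) (use G J w y in \<open>auto intro!: mult_mat_vec_carrier\<close>)
  also have "z + DU *\<^sub>v y + 0\<^sub>v k = z + DU *\<^sub>v y" using w by simp
  also have "(- ?G) *\<^sub>v (z + DU *\<^sub>v y) + ?J *\<^sub>v y = (- ?G) *\<^sub>v z + (?J - ?G * DU) *\<^sub>v y"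
  proof -
    have 1: "(- ?G) *\<^sub>v (z + DU *\<^sub>v y) = - (?G *\<^sub>v z) - ?G *\<^sub>v (DU *\<^sub>v y)"
      using G z Dy w carrier_matD[OF G] carrier_vecD[OF w] mult_add_distrib_mat_vec[OF G z Dy]
      by (intro eq_vecI) auto
    have 2: "(- ?G) *\<^sub>v z = - (?G *\<^sub>v z)" using G z carrier_matD[OF G] by simp
    have 3: "(?J - ?G * DU) *\<^sub>v y = ?J *\<^sub>v y - ?G *\<^sub>v (DU *\<^sub>v y)"
      using G J D y by (simp add: minus_mult_distrib_mat_vec[of _ p p] assoc_mult_mat_vec[of _ p k _ p])
    have c: "?G *\<^sub>v z \<in> carrier_vec p" "?G *\<^sub>v (DU *\<^sub>v y) \<in> carrier_vec p" "?J *\<^sub>v y \<in> carrier_vec p"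
      using G J z y Dy mult_mat_vec_carrier by blast+
    show ?thesis unfolding 1 2 3 using c by (intro eq_vecI) auto
  qed
  finally show ?thesis unfolding observer_estimate_def by simp
qed

text \<open>
  The estimate is \<open>L (z + D y) + K y\<close>, whereas the state is \<open>L P x + K C x\<close>.  The output
  component agrees, so the error lies in the kernel of \<open>C\<close>, with coordinates \<open>P x - z - D y\<close>.
\<close>

lemma estimation_error_eq:
  assumes C1: "C1 \<in> carrier_mat p k" and C2: "C2 \<in> carrier_mat p p" "invertible_mat C2"
    and D: "DU \<in> carrier_mat k p" and x: "x \<in> carrier_vec (k + p)" and z: "z \<in> carrier_vec k"
    and y: "y = (C1 @\<^sub>c C2) *\<^sub>v x"
  shows "x - observer_estimate C1 C2 DU z y =
    (1\<^sub>m k @\<^sub>r (- (mat_inv C2 * C1))) *\<^sub>v (((1\<^sub>m k @\<^sub>c 0\<^sub>m k p) - DU * (C1 @\<^sub>c C2)) *\<^sub>v x - z)"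
proof -
  define P L K C where "P = (1\<^sub>m k :: real mat) @\<^sub>c 0\<^sub>m k p" and "L = 1\<^sub>m k @\<^sub>r (- (mat_inv C2 * C1))"
    and "K = 0\<^sub>m k p @\<^sub>r mat_inv C2" and "C = C1 @\<^sub>c C2"
  interpret output_coordinates "k + p" k p P L K C
    unfolding P_def L_def K_def C_def by (rule output_coordinates_split(1)[OF C1 C2])
  have yc: "y \<in> carrier_vec p" using y C x unfolding C_def by simp
  have Px: "P *\<^sub>v x \<in> carrier_vec k" and Dy: "DU *\<^sub>v y \<in> carrier_vec k" and Ky: "K *\<^sub>v y \<in> carrier_vec (k + p)"
    using P D K x yc by auto
  have Lc: "L *\<^sub>v v \<in> carrier_vec (k + p)" if "v \<in> carrier_vec k" for v using L that by simp
  have swap: "a - b - c = a - (c + b)"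
    if "a \<in> carrier_vec k" "b \<in> carrier_vec k" "c \<in> carrier_vec k" for a b c :: "real vec"
    using that by (intro eq_vecI) auto
  have "(P - DU * C) *\<^sub>v x = P *\<^sub>v x - DU *\<^sub>v y"
    unfolding y C_def[symmetric] using P D C x by (simp add: minus_mult_distrib_mat_vec[of _ k "k + p"] assoc_mult_mat_vec[of _ k p _ "k + p"])
  then have r: "(P - DU * C) *\<^sub>v x - z = P *\<^sub>v x - (z + DU *\<^sub>v y)"
    using swap[OF Px Dy z] by simp
  have "L *\<^sub>v ((P - DU * C) *\<^sub>v x - z) = L *\<^sub>v (P *\<^sub>v x) - L *\<^sub>v (z + DU *\<^sub>v y)"
    unfolding r using L Px Dy z by (intro mult_minus_distrib_mat_vec) auto
  also have "\<dots> = x - (L *\<^sub>v (z + DU *\<^sub>v y) + K *\<^sub>v y)"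
  proof (rule eq_vecI)
    fix i assume "i < dim_vec (x - (L *\<^sub>v (z + DU *\<^sub>v y) + K *\<^sub>v y))"
    then have i: "i < k + p" using carrier_vecD[OF Ky] by simp
    have "(L *\<^sub>v (P *\<^sub>v x) + K *\<^sub>v y) $ i = x $ i" using decompose_vec[OF x] y C_def by simp
    moreover have "(L *\<^sub>v (P *\<^sub>v x) + K *\<^sub>v y) $ i = (L *\<^sub>v (P *\<^sub>v x)) $ i + (K *\<^sub>v y) $ i"
      using i carrier_vecD[OF Ky] by (intro index_add_vec) (simp only:)
    moreover have "dim_vec (L *\<^sub>v (z + DU *\<^sub>v y)) = k + p" "dim_vec (K *\<^sub>v y) = k + p" using L K by auto
    ultimately show "(L *\<^sub>v (P *\<^sub>v x) - L *\<^sub>v (z + DU *\<^sub>v y)) $ i = (x - (L *\<^sub>v (z + DU *\<^sub>v y) + K *\<^sub>v y)) $ i"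
      using i x by (simp del: index_mult_mat_vec)
  qed (use L K x in simp)
  finally have "L *\<^sub>v ((P - DU * C) *\<^sub>v x - z) = x - (L *\<^sub>v (z + DU *\<^sub>v y) + K *\<^sub>v y)" .
  then show ?thesis
    unfolding observer_estimate_eq[OF C1 output_coordinates_split(2)[OF C1 C2] D z yc] P_def L_def K_def C_def by simp
qed

lemma vec_tendsto_zero_mult_mat:
  assumes M: "M \<in> carrier_mat n k" and e: "\<And>t. e t \<in> carrier_vec k" and lim: "vec_tendsto_zero k e"
  shows "vec_tendsto_zero n (\<lambda>t. M *\<^sub>v e t)"
  unfolding vec_tendsto_zero_def
proof (intro allI impI)
  fix i assume i: "i < n"
  have "(\<lambda>t. (M *\<^sub>v e t) $ i) = (\<lambda>t. \<Sum>j<k. M $$ (i, j) * e t $ j)"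
    using i M carrier_vecD[OF e] by (simp add: scalar_prod_def atLeast0LessThan)
  then show "(\<lambda>t. (M *\<^sub>v e t) $ i) \<longlonglongrightarrow> 0" using lim unfolding vec_tendsto_zero_def
    by (auto intro!: tendsto_null_sum tendsto_mult_right_zero)
qed

text \<open>
  The full error is the image of the reduced one under the injective matrix \<open>L\<close>.
\<close>

lemma is_rUIO_iff_reduced_error:
  assumes A: "A \<in> carrier_mat (k + p) (k + p)" and B: "B \<in> carrier_mat (k + p) m" 
    and C1: "C1 \<in> carrier_mat p k" and C2: "C2 \<in> carrier_mat p p" "invertible_mat C2"
  defines "C \<equiv> C1 @\<^sub>c C2"
  shows "is_rUIO A B E C1 C2 AU Bu By DU \<longleftrightarrow>
     AU \<in> carrier_mat k k \<and> Bu \<in> carrier_mat k m \<and> By \<in> carrier_mat k p \<and> DU \<in> carrier_mat k p \<and>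
     (\<forall>u d x y z. sys_trajectory A B E C u d x y \<longrightarrow> observer_state AU Bu By u y z \<longrightarrow>
        vec_tendsto_zero k (\<lambda>t. ((1\<^sub>m k @\<^sub>c 0\<^sub>m k p) - DU * C) *\<^sub>v x t - z t))"
proof -
  define P L K where "P = (1\<^sub>m k :: real mat) @\<^sub>c 0\<^sub>m k p" and "L = 1\<^sub>m k @\<^sub>r (- (mat_inv C2 * C1))"
    and "K = 0\<^sub>m k p @\<^sub>r mat_inv C2"
  interpret output_coordinates "k + p" k p P L K C
    unfolding P_def L_def K_def C_def by (rule output_coordinates_split(1)[OF C1 C2])
  have "vec_tendsto_zero (k + p) (\<lambda>t. x t - observer_estimate C1 C2 DU (z t) (y t)) \<longleftrightarrow>
      vec_tendsto_zero k (\<lambda>t. (P - DU * C) *\<^sub>v x t - z t)"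
    if AU: "AU \<in> carrier_mat k k" and DU: "DU \<in> carrier_mat k p"
      and sys: "sys_trajectory A B E C u d x y" and obs: "observer_state AU Bu By u y z" for u d x y z
  proof -
    have x: "x t \<in> carrier_vec (k + p)" and y: "y t = C *\<^sub>v x t" for t
      using sys A unfolding sys_trajectory_def by auto
    have z: "z t \<in> carrier_vec k" for t using obs AU unfolding observer_state_def by auto
    define e where "e t = (P - DU * C) *\<^sub>v x t - z t" for t
    have e: "e t \<in> carrier_vec k" for t
      using P DU C x[of t] z[of t] unfolding e_def by (intro minus_carrier_vec mult_mat_vec_carrier[of _ k "k + p"]) auto
    have err: "x t - observer_estimate C1 C2 DU (z t) (y t) = L *\<^sub>v e t" for t
      using estimation_error_eq[OF C1 C2 DU x z y[unfolded C_def]] unfolding e_def P_def L_def C_def by simp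
    have "P *\<^sub>v (L *\<^sub>v e t) = e t" for t
      using assoc_mult_mat_vec[OF P L e] e PL by (simp add: one_mult_mat_vec)
    then show ?thesis unfolding err e_def[symmetric]
      using vec_tendsto_zero_mult_mat[OF L e] vec_tendsto_zero_mult_mat[OF P, of "\<lambda>t. L *\<^sub>v e t"] L e by auto
  qed
  then show ?thesis
    unfolding is_rUIO_def P_def[symmetric] C_def[symmetric] using A B C1 by auto
qed

section \<open>From the data equation to an observer\<close>

context output_coordinates
begin

text \<open>
  Inserting the dynamics at time \<open>t + 1\<close> turns the data equation into
  \<open>(F B - S1) u + F E d + (F A - S2 C - S4 P) x = 0\<close> at every sample, and the samples are rich
  enough to force the three coefficient matrices to vanish.
\<close>

lemma data_equation_imp_observer_equations:
  assumes A: "A \<in> carrier_mat n n" and B: "B \<in> carrier_mat n m" and E: "E \<in> carrier_mat n q"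
    and S: "S1 \<in> carrier_mat k m" "S2 \<in> carrier_mat k p" "S3 \<in> carrier_mat k p" "S4 \<in> carrier_mat k k"
    and u: "\<And>t. t < T - 1 \<Longrightarrow> u t \<in> carrier_vec m" and d: "\<And>t. t < T - 1 \<Longrightarrow> d t \<in> carrier_vec q"
    and x: "\<And>t. t < T - 1 \<Longrightarrow> x t \<in> carrier_vec n"
    and rank: "vec_space.rank (m + q + n) (past_mat T m u @\<^sub>r past_mat T q d @\<^sub>r past_mat T n x) = m + q + n"
    and xS: "\<And>t. t < T - 1 \<Longrightarrow> x (Suc t) = A *\<^sub>v x t + B *\<^sub>v u t + E *\<^sub>v d t"
    and sol: "\<And>t. t < T - 1 \<Longrightarrow> P *\<^sub>v x (Suc t) =
       S1 *\<^sub>v u t + (S2 *\<^sub>v (C *\<^sub>v x t) + (S3 *\<^sub>v (C *\<^sub>v x (Suc t)) + S4 *\<^sub>v (P *\<^sub>v x t)))"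
  defines "F \<equiv> P - S3 * C"
  shows "F * B = S1" "F * E = 0\<^sub>m k q" "F * A = S2 * C + S4 * P"
proof -
  have F: "F \<in> carrier_mat k n" unfolding F_def by (rule minus_carrier_mat[OF mult_carrier_mat[OF S(3) C]])
  note SC = mult_carrier_mat[OF S(2) C] and SP = mult_carrier_mat[OF S(4) P]
  have FB: "F * B \<in> carrier_mat k m" and FE: "F * E \<in> carrier_mat k q" and FA: "F * A \<in> carrier_mat k n"
    using F A B E by auto
  have "(F * B - S1) *\<^sub>v u t + (F * E) *\<^sub>v d t + (F * A - (S2 * C + S4 * P)) *\<^sub>v x t = 0\<^sub>v k" if t: "t < T - 1" for t
  proof -
    note ut = u[OF t] and dt = d[OF t] and xt = x[OF t]
    have Axt: "A *\<^sub>v x t \<in> carrier_vec n" and But: "B *\<^sub>v u t \<in> carrier_vec n" and Edt: "E *\<^sub>v d t \<in> carrier_vec n"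
      using A B E xt ut dt by (auto intro: mult_mat_vec_carrier)
    have xSt: "x (Suc t) \<in> carrier_vec n" unfolding xS[OF t] using Axt But Edt by simp
    define a b c f g h l where "a = S2 *\<^sub>v (C *\<^sub>v x t)" and "b = S4 *\<^sub>v (P *\<^sub>v x t)" and "c = S1 *\<^sub>v u t"
      and "f = F * A *\<^sub>v x t" and "g = F * B *\<^sub>v u t" and "h = F * E *\<^sub>v d t" and "l = S3 *\<^sub>v (C *\<^sub>v x (Suc t))"
    have car: "a \<in> carrier_vec k" "b \<in> carrier_vec k" "c \<in> carrier_vec k" "f \<in> carrier_vec k"
       "g \<in> carrier_vec k" "h \<in> carrier_vec k" "l \<in> carrier_vec k"
      unfolding a_def b_def c_def f_def g_def h_def l_def
      using mult_mat_vec_carrier S C P FA FB FE xt ut dt xSt by meson+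
    have "F *\<^sub>v x (Suc t) = F *\<^sub>v (A *\<^sub>v x t) + F *\<^sub>v (B *\<^sub>v u t) + F *\<^sub>v (E *\<^sub>v d t)"
      unfolding xS[OF t] using mult_add_distrib_mat_vec[OF F add_carrier_vec[OF Axt But] Edt] mult_add_distrib_mat_vec[OF F Axt But] by simp
    then have 1: "F *\<^sub>v x (Suc t) = f + g + h"
      unfolding f_def g_def h_def assoc_mult_mat_vec[OF F A xt] assoc_mult_mat_vec[OF F B ut] assoc_mult_mat_vec[OF F E dt] .
    have "F *\<^sub>v x (Suc t) = P *\<^sub>v x (Suc t) - l"
      unfolding F_def l_def using minus_mult_distrib_mat_vec[OF P mult_carrier_mat[OF S(3) C] xSt]
        assoc_mult_mat_vec[OF S(3) C xSt] by simp
    also have "P *\<^sub>v x (Suc t) = c + (a + (l + b))" unfolding a_def b_def c_def l_def by (rule sol[OF t])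
    finally have 2: "f + g + h = c + (a + (l + b)) - l" unfolding 1 .
    have "f $ i + g $ i + h $ i = c $ i + a $ i + b $ i" if i: "i < k" for i
    proof -
      have "(f + g + h) $ i = (c + (a + (l + b)) - l) $ i" unfolding 2 ..
      then show ?thesis using car i by simp
    qed
    then have "(g - c) + h + (f - (a + b)) = 0\<^sub>v k" using car by (intro eq_vecI) (auto simp: algebra_simps)
    then show ?thesis
      unfolding minus_mult_distrib_mat_vec[OF FB S(1) ut] minus_mult_distrib_mat_vec[OF FA add_carrier_mat[OF SP] xt]
        add_mult_distrib_mat_vec[OF SC SP xt] assoc_mult_mat_vec[OF S(2) C xt] assoc_mult_mat_vec[OF S(4) P xt]
        a_def b_def c_def f_def g_def h_def .
  qed
  from full_row_rank_samples_mat[OF u d x rank _ FE _ this]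
  have zero: "F * B - S1 = 0\<^sub>m k m" "F * E = 0\<^sub>m k q" "F * A - (S2 * C + S4 * P) = 0\<^sub>m k n"
    using minus_carrier_mat[OF S(1)] minus_carrier_mat[OF add_carrier_mat[OF SP]] by blast+
  have eq: "M = N" if "M \<in> carrier_mat r s" "N \<in> carrier_mat r s" "M - N = 0\<^sub>m r s" for M N :: "real mat" and r s
  proof (rule eq_matI)
    fix i j assume ij: "i < dim_row N" "j < dim_col N"
    have "(M - N) $$ (i, j) = 0" unfolding that(3) using ij that(2) by simp
    then show "M $$ (i, j) = N $$ (i, j)" using ij by simp
  qed (use that in auto)
  show "F * B = S1" by (rule eq[OF FB S(1) zero(1)])
  show "F * E = 0\<^sub>m k q" by (rule zero(2))
  show "F * A = S2 * C + S4 * P" by (rule eq[OF FA add_carrier_mat[OF SP] zero(3)])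
qed

text \<open>
  The term \<open>S4 S3\<close> in the output gain of the observer accounts for its state tracking \<open>F x\<close> instead
  of \<open>P x\<close>.  With it, the inputs and the disturbance drop out of the error recursion.
\<close>

lemma observer_equations_imp_error_tendsto_zero:
  assumes A: "A \<in> carrier_mat n n" and B: "B \<in> carrier_mat n m" and E: "E \<in> carrier_mat n q"
    and S: "S1 \<in> carrier_mat k m" "S2 \<in> carrier_mat k p" "S3 \<in> carrier_mat k p" "S4 \<in> carrier_mat k k"
    and F: "F = P - S3 * C"
    and FB: "F * B = S1" and FE: "F * E = 0\<^sub>m k q" and FA: "F * A = S2 * C + S4 * P"
    and st: "schur_stable S4"
    and sys: "sys_trajectory A B E C u d x y" and obs: "observer_state S4 S1 (S2 + S4 * S3) u y z"
  shows "vec_tendsto_zero k (\<lambda>t. F *\<^sub>v x t - z t)"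
proof -
  have ut: "u t \<in> carrier_vec m" and dt: "d t \<in> carrier_vec q" and xt: "x t \<in> carrier_vec n"
    and xS: "x (Suc t) = A *\<^sub>v x t + B *\<^sub>v u t + E *\<^sub>v d t" and y: "y t = C *\<^sub>v x t" for t
    using sys A B E unfolding sys_trajectory_def by auto
  have yt: "y t \<in> carrier_vec p" for t unfolding y using C xt by (rule mult_mat_vec_carrier)
  have zt: "z t \<in> carrier_vec k" and zS: "z (Suc t) = S4 *\<^sub>v z t + S1 *\<^sub>v u t + (S2 + S4 * S3) *\<^sub>v y t" for t
    using obs S unfolding observer_state_def by auto
  have F': "F \<in> carrier_mat k n" unfolding F by (rule minus_carrier_mat[OF mult_carrier_mat[OF S(3) C]])
  have e: "F *\<^sub>v x t - z t \<in> carrier_vec k" for t using F' xt zt by simp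
  have rec: "F *\<^sub>v x (Suc t) - z (Suc t) = S4 *\<^sub>v (F *\<^sub>v x t - z t)" for t
  proof -
    define a b c g h where "a = S2 *\<^sub>v y t" and "b = S4 *\<^sub>v (P *\<^sub>v x t)" and "c = S1 *\<^sub>v u t"
      and "g = S4 *\<^sub>v (S3 *\<^sub>v y t)" and "h = S4 *\<^sub>v z t"
    have Px: "P *\<^sub>v x t \<in> carrier_vec k" using P xt by (rule mult_mat_vec_carrier)
    have S3y: "S3 *\<^sub>v y t \<in> carrier_vec k" using S(3) yt by (rule mult_mat_vec_carrier)
    have car: "a \<in> carrier_vec k" "b \<in> carrier_vec k" "c \<in> carrier_vec k" "g \<in> carrier_vec k" "h \<in> carrier_vec k"
      unfolding a_def b_def c_def g_def h_def
      using mult_mat_vec_carrier S yt[of t] Px S3y ut[of t] zt[of t] by blast+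
    have Axt: "A *\<^sub>v x t \<in> carrier_vec n" and But: "B *\<^sub>v u t \<in> carrier_vec n" and Edt: "E *\<^sub>v d t \<in> carrier_vec n"
      using A B E xt ut dt by (auto intro: mult_mat_vec_carrier)
    have "F *\<^sub>v x (Suc t) = F *\<^sub>v (A *\<^sub>v x t) + F *\<^sub>v (B *\<^sub>v u t) + F *\<^sub>v (E *\<^sub>v d t)"
      unfolding xS using mult_add_distrib_mat_vec[OF F' add_carrier_vec[OF Axt But] Edt] mult_add_distrib_mat_vec[OF F' Axt But] by simp
    also have "F *\<^sub>v (A *\<^sub>v x t) = a + b"
      using assoc_mult_mat_vec[OF F' A xt[of t]] add_mult_distrib_mat_vec[OF mult_carrier_mat[OF S(2) C] mult_carrier_mat[OF S(4) P] xt[of t]]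
        assoc_mult_mat_vec[OF S(2) C xt[of t]] assoc_mult_mat_vec[OF S(4) P xt[of t]]
      unfolding FA a_def b_def y by simp
    also have "F *\<^sub>v (B *\<^sub>v u t) = c" using assoc_mult_mat_vec[OF F' B ut[of t]] unfolding FB c_def by simp
    also have "F *\<^sub>v (E *\<^sub>v d t) = 0\<^sub>v k"
      using assoc_mult_mat_vec[OF F' E dt[of t]] zero_mat_mult_vec[OF dt] unfolding FE by simp
    finally have 1: "F *\<^sub>v x (Suc t) = a + b + c + 0\<^sub>v k" .
    have 2: "z (Suc t) = h + c + (a + g)"
      unfolding zS a_def c_def g_def h_def
      using add_mult_distrib_mat_vec[OF S(2) mult_carrier_mat[OF S(4) S(3)] yt[of t]] assoc_mult_mat_vec[OF S(4) S(3) yt[of t]]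
      by simp
    have "F *\<^sub>v x t = P *\<^sub>v x t - S3 *\<^sub>v y t"
      unfolding F y using minus_mult_distrib_mat_vec[OF P mult_carrier_mat[OF S(3) C] xt[of t]]
        assoc_mult_mat_vec[OF S(3) C xt[of t]] by simp
    then have 3: "S4 *\<^sub>v (F *\<^sub>v x t - z t) = b - g - h"
      unfolding b_def g_def h_def using mult_minus_distrib_mat_vec[OF S(4) minus_carrier_vec[OF Px S3y] zt[of t]]
        mult_minus_distrib_mat_vec[OF S(4) Px S3y] by simp
    show ?thesis unfolding 1 2 3 using car by (intro eq_vecI) auto
  qed
  show ?thesis unfolding vec_tendsto_zero_def
    using schur_stable_recursion_tendsto_zero[OF S(4) st, of "\<lambda>t. F *\<^sub>v x t - z t", OF e rec] by blast
qed

end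

section \<open>The error response of an observer\<close>

text \<open>
  In terms of power series: if \<open>f = X\<^sup>r g\<close> with \<open>g(0) \<noteq> 0\<close>, then \<open>g\<close> is invertible, and for
  \<open>h = 1 / (g (1 - X))\<close> all coefficients of \<open>f h = X\<^sup>r / (1 - X)\<close> from index \<open>r\<close> on are one.
\<close>

lemma convolution_tendsto_zero_imp_zero:
  fixes a :: "nat \<Rightarrow> real"
  assumes conv: "\<And>c. (\<lambda>t. \<Sum>s<t. a s * c (t - 1 - s)) \<longlonglongrightarrow> 0"
  shows "a s = 0"
proof (rule ccontr)
  assume "a s \<noteq> 0"
  define f where "f = Abs_fps a"
  have f: "f \<noteq> 0" using \<open>a s \<noteq> 0\<close> unfolding f_def by (auto simp: fps_eq_iff)
  define r where "r = subdegree f"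
  define g where "g = fps_shift r f"
  have "fps_nth g 0 \<noteq> 0" using f unfolding g_def r_def by simp
  then have inv: "g * inverse g = 1" by (rule inverse_mult_eq_1')
  define h where "h = inverse g * Abs_fps (\<lambda>_. 1)"
  have "f = g * fps_X ^ r" unfolding g_def r_def by (rule subdegree_decompose)
  then have "f * h = (g * inverse g) * (fps_X ^ r * Abs_fps (\<lambda>_. 1))" unfolding h_def by (simp only: mult_ac)
  then have fh: "fps_nth (f * h) t = (if t < r then 0 else 1)" for t
    unfolding inv by (simp add: fps_X_power_mult_nth)
  have "(\<Sum>s<Suc t. a s * fps_nth h (Suc t - 1 - s)) = fps_nth (f * h) t" for t
    unfolding f_def fps_mult_nth by (simp add: atLeast0AtMost lessThan_Suc_atMost)
  then have "(\<lambda>t. fps_nth (f * h) t) \<longlonglongrightarrow> 0"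
    using LIMSEQ_Suc[OF conv[of "fps_nth h"]] by simp
  moreover have "(\<lambda>t. fps_nth (f * h) t) \<longlonglongrightarrow> 1"
    by (rule tendsto_eventually) (auto simp: fh eventually_at_top_linorder intro!: exI[of _ r])
  ultimately show False using LIMSEQ_unique by fastforce
qed

text \<open>
  The observer state obeys \<open>z(t+1) = AU z(t) + R x(t)\<close> with \<open>R = By C\<close> in the absence of a known
  input.  Without disturbances, unrolling the first step, from \<open>x(0)\<close> to \<open>A x(0)\<close> and from \<open>0\<close> to \<open>R x(0)\<close>, yields this
  recursion for the matrix that maps \<open>x(0)\<close> to \<open>F x(t) - z(t)\<close> when \<open>z(0) = 0\<close>.
\<close>

primrec error_response :: "real mat \<Rightarrow> real mat \<Rightarrow> real mat \<Rightarrow> real mat \<Rightarrow> nat \<Rightarrow> real mat" where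
  "error_response F AU R A 0 = F"
| "error_response F AU R A (Suc t) = error_response F AU R A t * A - AU ^\<^sub>m t * R"

lemma error_response_carrier:
  assumes "F \<in> carrier_mat k n" "AU \<in> carrier_mat k k" "R \<in> carrier_mat k n" "A \<in> carrier_mat n n"
  shows "error_response F AU R A t \<in> carrier_mat k n"
proof (cases t)
  case (Suc s)
  then show ?thesis using assms pow_carrier_mat[OF assms(2), of s] by (auto intro!: minus_carrier_mat)
qed (use assms in simp)

text \<open>
  Disturbances \<open>c t\<close> act along one fixed direction \<open>b\<close>.  The recursion for \<open>error_response\<close> peels off
  the first time step, so the induction shifts the trajectory by one step.
\<close>

lemma error_response_superposition:
  assumes F: "F \<in> carrier_mat k n" and AU: "AU \<in> carrier_mat k k" and R: "R \<in> carrier_mat k n"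
    and A: "A \<in> carrier_mat n n" and b: "b \<in> carrier_vec n" and i: "i < k"
    and "\<And>t. x t \<in> carrier_vec n" "\<And>t. z t \<in> carrier_vec k"
    and "\<And>t. x (Suc t) = A *\<^sub>v x t + c t \<cdot>\<^sub>v b" "\<And>t. z (Suc t) = AU *\<^sub>v z t + R *\<^sub>v x t"
  shows "(F *\<^sub>v x t - z t) $ i = (error_response F AU R A t *\<^sub>v x 0 - AU ^\<^sub>m t *\<^sub>v z 0) $ i
    + (\<Sum>s<t. (error_response F AU R A s *\<^sub>v b) $ i * c (t - 1 - s))"
  using assms(7-10)
proof (induction t arbitrary: x z c)
  case 0
  show ?case using AU 0(2) by simp
next
  case (Suc t)
  let ?H = "error_response F AU R A"
  have H: "?H t \<in> carrier_mat k n" for t using F AU R A by (rule error_response_carrier)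
  have G: "AU ^\<^sub>m t \<in> carrier_mat k k" by (rule pow_carrier_mat[OF AU])
  have x0: "x 0 \<in> carrier_vec n" and z0: "z 0 \<in> carrier_vec k" using Suc.prems by auto
  have "(F *\<^sub>v x (Suc t) - z (Suc t)) $ i = (?H t *\<^sub>v x (Suc 0) - AU ^\<^sub>m t *\<^sub>v z (Suc 0)) $ i
    + (\<Sum>s<t. (?H s *\<^sub>v b) $ i * c (Suc (t - 1 - s)))"
    using Suc.IH[of "\<lambda>t. x (Suc t)" "\<lambda>t. z (Suc t)" "\<lambda>t. c (Suc t)"] Suc.prems by blast
  also have "(\<Sum>s<t. (?H s *\<^sub>v b) $ i * c (Suc (t - 1 - s))) = (\<Sum>s<t. (?H s *\<^sub>v b) $ i * c (Suc t - 1 - s))"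
    by (rule sum.cong) (auto simp: Suc_diff_Suc)
  also have "(?H t *\<^sub>v x (Suc 0) - AU ^\<^sub>m t *\<^sub>v z (Suc 0)) $ i =
      (?H (Suc t) *\<^sub>v x 0 - AU ^\<^sub>m Suc t *\<^sub>v z 0) $ i + c 0 * (?H t *\<^sub>v b) $ i"
  proof -
    have Ax: "A *\<^sub>v x 0 \<in> carrier_vec n" and cb: "c 0 \<cdot>\<^sub>v b \<in> carrier_vec n" and
      Az: "AU *\<^sub>v z 0 \<in> carrier_vec k" and Rx: "R *\<^sub>v x 0 \<in> carrier_vec k"
      using A AU R x0 z0 b by auto
    have 1: "?H t *\<^sub>v x (Suc 0) = ?H t *\<^sub>v (A *\<^sub>v x 0) + c 0 \<cdot>\<^sub>v (?H t *\<^sub>v b)"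
      unfolding Suc.prems(3) mult_add_distrib_mat_vec[OF H Ax cb] mult_mat_vec[OF H b] ..
    have 2: "AU ^\<^sub>m t *\<^sub>v z (Suc 0) = AU ^\<^sub>m Suc t *\<^sub>v z 0 + AU ^\<^sub>m t *\<^sub>v (R *\<^sub>v x 0)"
      unfolding Suc.prems(4) mult_add_distrib_mat_vec[OF G Az Rx] pow_mat.simps assoc_mult_mat_vec[OF G AU z0] ..
    have 3: "?H (Suc t) *\<^sub>v x 0 = ?H t *\<^sub>v (A *\<^sub>v x 0) - AU ^\<^sub>m t *\<^sub>v (R *\<^sub>v x 0)"
      unfolding error_response.simps
        minus_mult_distrib_mat_vec[OF mult_carrier_mat[OF H A] mult_carrier_mat[OF G R] x0]
        assoc_mult_mat_vec[OF G R x0] assoc_mult_mat_vec[OF H A x0] ..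
    define v1 v2 v3 v4 where "v1 = ?H t *\<^sub>v (A *\<^sub>v x 0)" and "v2 = ?H t *\<^sub>v b"
      and "v3 = AU ^\<^sub>m Suc t *\<^sub>v z 0" and "v4 = AU ^\<^sub>m t *\<^sub>v (R *\<^sub>v x 0)"
    have "v1 \<in> carrier_vec k" "v2 \<in> carrier_vec k" "v3 \<in> carrier_vec k" "v4 \<in> carrier_vec k"
      unfolding v1_def v2_def v3_def v4_def
      using mult_mat_vec_carrier[OF H Ax] mult_mat_vec_carrier[OF H b] mult_mat_vec_carrier[OF G Rx]
        mult_mat_vec_carrier[OF pow_carrier_mat[OF AU] z0] by blast+
    then show ?thesis unfolding 1 2 3 v1_def[symmetric] v2_def[symmetric] v3_def[symmetric] v4_def[symmetric]
      using i by simp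
  qed
  finally show ?case by simp
qed

context output_coordinates
begin

text \<open>
  Constant zero disturbance gives the first claim.  For the second one, the state starts at zero: the
  error is then the convolution of the scalar disturbance with an entry of \<open>H s E\<close>, and it tends to
  zero for every disturbance.
\<close>

lemma rUIO_imp_error_response:
  assumes A: "A \<in> carrier_mat n n" and B: "B \<in> carrier_mat n m" and E: "E \<in> carrier_mat n q"
    and O: "AU \<in> carrier_mat k k" "Bu \<in> carrier_mat k m" "By \<in> carrier_mat k p" and F: "F \<in> carrier_mat k n"
    and conv: "\<And>u d x y z. sys_trajectory A B E C u d x y \<Longrightarrow> observer_state AU Bu By u y z \<Longrightarrow>
        vec_tendsto_zero k (\<lambda>t. F *\<^sub>v x t - z t)"
  defines "H \<equiv> error_response F AU (By * C) A"
  shows "\<And>v. v \<in> carrier_vec n \<Longrightarrow> vec_tendsto_zero k (\<lambda>t. H t *\<^sub>v v)"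
    and "\<And>s. H s * E = 0\<^sub>m k q"
proof -
  have R: "By * C \<in> carrier_mat k n" using O C by simp
  have H: "H t \<in> carrier_mat k n" for t unfolding H_def using F O(1) R A by (rule error_response_carrier)
  have lim: "(\<lambda>t. (H t *\<^sub>v x0) $ i + (\<Sum>s<t. (H s *\<^sub>v (E *\<^sub>v w)) $ i * c (t - 1 - s))) \<longlonglongrightarrow> 0"
    if x0: "x0 \<in> carrier_vec n" and w: "w \<in> carrier_vec q" and i: "i < k" for x0 w c i
  proof -
    define b where "b = E *\<^sub>v w"
    have b: "b \<in> carrier_vec n" unfolding b_def using E w by (rule mult_mat_vec_carrier)
    define x where "x = rec_nat x0 (\<lambda>t v. A *\<^sub>v v + c t \<cdot>\<^sub>v b)"
    define z where "z = rec_nat (0\<^sub>v k) (\<lambda>t v. AU *\<^sub>v v + (By * C) *\<^sub>v x t)"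
    have x: "x t \<in> carrier_vec n" for t
      by (induction t) (use x0 A b in \<open>auto simp: x_def\<close>)
    have z: "z t \<in> carrier_vec k" for t
      by (induction t) (use O R x in \<open>auto simp: z_def intro!: add_carrier_vec mult_mat_vec_carrier[OF R]\<close>)
    have xS: "x (Suc t) = A *\<^sub>v x t + c t \<cdot>\<^sub>v b" and zS: "z (Suc t) = AU *\<^sub>v z t + (By * C) *\<^sub>v x t" for t
      unfolding x_def z_def by simp_all
    have B0: "B *\<^sub>v 0\<^sub>v m = 0\<^sub>v n" and Bu0: "Bu *\<^sub>v 0\<^sub>v m = 0\<^sub>v k" using B O(2) by (auto intro: mat_mult_zero_vec)
    have "sys_trajectory A B E C (\<lambda>_. 0\<^sub>v m) (\<lambda>t. c t \<cdot>\<^sub>v w) x (\<lambda>t. C *\<^sub>v x t)"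
      unfolding sys_trajectory_def xS mult_mat_vec[OF E w] b_def[symmetric]
      using A B E w x b B0 mult_mat_vec_carrier[OF A x] by auto
    moreover have "observer_state AU Bu By (\<lambda>_. 0\<^sub>v m) (\<lambda>t. C *\<^sub>v x t) z"
      unfolding observer_state_def zS assoc_mult_mat_vec[OF O(3) C x]
      using O z Bu0 mult_mat_vec_carrier[OF O(1) z] by auto
    ultimately have "(\<lambda>t. (F *\<^sub>v x t - z t) $ i) \<longlonglongrightarrow> 0"
      using conv i unfolding vec_tendsto_zero_def by blast
    moreover have "(F *\<^sub>v x t - z t) $ i = (H t *\<^sub>v x0) $ i + (\<Sum>s<t. (H s *\<^sub>v b) $ i * c (t - 1 - s))" for t
    proof -
      have "AU ^\<^sub>m t *\<^sub>v z 0 = 0\<^sub>v k"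
        unfolding z_def using mat_mult_zero_vec[OF pow_carrier_mat[OF O(1)]] by simp
      then have "H t *\<^sub>v x 0 - AU ^\<^sub>m t *\<^sub>v z 0 = H t *\<^sub>v x0"
        using mult_mat_vec_carrier[OF H[of t] x0] unfolding x_def by (simp add: minus_zero_vec)
      with error_response_superposition[where x = x and z = z and c = c and t = t, OF F O(1) R A b i x z xS zS]
      show ?thesis unfolding H_def by simp
    qed
    ultimately show ?thesis unfolding b_def by simp
  qed
  have H0: "H s *\<^sub>v 0\<^sub>v n = 0\<^sub>v k" for s by (rule mat_mult_zero_vec[OF H])
  show "vec_tendsto_zero k (\<lambda>t. H t *\<^sub>v v)" if v: "v \<in> carrier_vec n" for v
    using lim[OF v zero_carrier_vec, of _ "\<lambda>_. 0"] unfolding vec_tendsto_zero_def by simp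
  show "H s * E = 0\<^sub>m k q" for s
  proof (rule eq_matI)
    fix i j assume "i < dim_row (0\<^sub>m k q :: real mat)" "j < dim_col (0\<^sub>m k q :: real mat)"
    then have i: "i < k" and j: "j < q" by auto
    have "(H s *\<^sub>v (E *\<^sub>v unit_vec q j)) $ i = 0"
      by (rule convolution_tendsto_zero_imp_zero[of "\<lambda>s. (H s *\<^sub>v (E *\<^sub>v unit_vec q j)) $ i"])
         (use lim[OF zero_carrier_vec unit_vec_carrier i, of j] i in \<open>simp add: H0 del: index_mult_mat_vec\<close>)
    moreover have "E *\<^sub>v unit_vec q j = col E j" using E j by (auto intro!: eq_vecI)
    ultimately show "(H s * E) $$ (i, j) = 0\<^sub>m k q $$ (i, j)" using i j H[of s] E carrier_matD[OF H[of s]] by simp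
  qed (use H[of s] E in auto)
qed

end

section \<open>A stabilizing left inverse\<close>

fun gram :: "nat \<Rightarrow> (nat \<Rightarrow> real mat) \<Rightarrow> nat \<Rightarrow> real mat" where
  "gram n H 0 = 0\<^sub>m n n"
| "gram n H (Suc N) = gram n H N + (H N)\<^sup>T * H N"

lemma gram_carrier:
  assumes "\<And>s. H s \<in> carrier_mat k n"
  shows "gram n H N \<in> carrier_mat n n"
proof (induction N)
  case (Suc N)
  have "(H N)\<^sup>T * H N \<in> carrier_mat n n" using assms[of N] by auto
  then show ?case using Suc by simp
qed simp

lemma gram_form:
  assumes H: "\<And>s. H s \<in> carrier_mat k n" and v: "v \<in> carrier_vec n" and w: "w \<in> carrier_vec n"
  shows "v \<bullet> (gram n H N *\<^sub>v w) = (\<Sum>s<N. (H s *\<^sub>v v) \<bullet> (H s *\<^sub>v w))"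
proof (induction N)
  case 0
  have "(0\<^sub>m n n :: real mat) *\<^sub>v w = 0\<^sub>v n" using w by (intro eq_vecI) auto
  then show ?case using v by simp
next
  case (Suc N)
  have HN: "(H N)\<^sup>T \<in> carrier_mat n k" and Hw: "H N *\<^sub>v w \<in> carrier_vec k" using H[of N] w by auto
  have "gram n H (Suc N) *\<^sub>v w = gram n H N *\<^sub>v w + (H N)\<^sup>T *\<^sub>v (H N *\<^sub>v w)"
    unfolding gram.simps add_mult_distrib_mat_vec[OF gram_carrier[OF H] mult_carrier_mat[OF HN H] w]
      assoc_mult_mat_vec[OF HN H w] ..
  moreover have "v \<bullet> ((H N)\<^sup>T *\<^sub>v (H N *\<^sub>v w)) = (H N *\<^sub>v v) \<bullet> (H N *\<^sub>v w)"
    by (rule transpose_scalar_prod[OF H v Hw])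
  ultimately show ?case
    using Suc scalar_prod_add_distrib[OF v mult_mat_vec_carrier[OF gram_carrier[OF H] w] mult_mat_vec_carrier[OF HN Hw]]
    by simp
qed

lemma gram_mult_zero:
  assumes H: "\<And>s. H s \<in> carrier_mat k n" and E: "E \<in> carrier_mat n q" and HE: "\<And>s. H s * E = 0\<^sub>m k q"
  shows "gram n H N * E = 0\<^sub>m n q"
proof (induction N)
  case 0
  show ?case using E by simp
next
  case (Suc N)
  have HN: "(H N)\<^sup>T \<in> carrier_mat n k" using H[of N] by simp
  have "gram n H (Suc N) * E = gram n H N * E + (H N)\<^sup>T * (H N * E)"
    unfolding gram.simps add_mult_distrib_mat[OF gram_carrier[OF H] mult_carrier_mat[OF HN H] E]
      assoc_mult_mat[OF HN H E] ..
  then show ?case unfolding Suc HE using HN by simp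
qed

lemma small_entries_contract:
  fixes M :: "real mat"
  assumes M: "M \<in> carrier_mat k k" and small: "(\<Sum>i<k. \<Sum>j<k. (M $$ (i, j))\<^sup>2) < 1"
    and v: "v \<in> carrier_vec k" "v \<noteq> 0\<^sub>v k"
  shows "(M *\<^sub>v v) \<bullet> (M *\<^sub>v v) < v \<bullet> v"
proof -
  have vv: "v \<bullet> v = (\<Sum>j<k. (v $ j)\<^sup>2)" using v by (simp add: scalar_prod_def atLeast0LessThan power2_eq_square)
  have pos: "0 < v \<bullet> v" using scalar_prod_self_eq_0[OF v(1)] scalar_prod_self_nonneg[of v] v(2) by linarith
  have "(M *\<^sub>v v) \<bullet> (M *\<^sub>v v) = (\<Sum>i<k. (\<Sum>j<k. M $$ (i, j) * v $ j)\<^sup>2)"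
    using M v by (simp add: scalar_prod_def atLeast0LessThan power2_eq_square)
  also have "\<dots> \<le> (\<Sum>i<k. (\<Sum>j<k. (M $$ (i, j))\<^sup>2) * (v \<bullet> v))"
    unfolding vv by (intro sum_mono Cauchy_Schwarz_ineq_sum)
  also have "\<dots> = (\<Sum>i<k. \<Sum>j<k. (M $$ (i, j))\<^sup>2) * (v \<bullet> v)" by (simp add: sum_distrib_right)
  also have "\<dots> < 1 * (v \<bullet> v)" using small pos by (intro mult_strict_right_mono)
  finally show ?thesis by simp
qed

text \<open>
  \<open>L F\<close> is the orthogonal projection onto the range of \<open>L\<close> for the Gram form \<open>Q\<close> of
  \<open>H 0, \<dots>, H (N - 1)\<close>; the explicit formula is the one of weighted least squares.  The form may be
  degenerate, but it is definite on the range of \<open>L\<close> because of the summand for \<open>H 0\<close>.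
\<close>

lemma stabilizing_left_inverse:
  assumes H: "\<And>s. H s \<in> carrier_mat k n" and A: "A \<in> carrier_mat n n" and L: "L \<in> carrier_mat n k"
    and E: "E \<in> carrier_mat n q"
    and H0: "H 0 * L = 1\<^sub>m k" and HSuc: "\<And>s. H (Suc s) * L = H s * A * L" and HE: "\<And>s. H s * E = 0\<^sub>m k q"
    and small: "\<And>v. v \<in> carrier_vec k \<Longrightarrow> v \<noteq> 0\<^sub>v k \<Longrightarrow> (H N * L *\<^sub>v v) \<bullet> (H N * L *\<^sub>v v) < v \<bullet> v"
    and N: "N > 0"
  shows "\<exists>F \<in> carrier_mat k n. F * L = 1\<^sub>m k \<and> F * E = 0\<^sub>m k q \<and> schur_stable (F * A * L)"
proof -
  define X where "X = gram n H N"
  have X: "X \<in> carrier_mat n n" unfolding X_def by (rule gram_carrier[OF H])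
  have LT: "L\<^sup>T \<in> carrier_mat k n" using L by simp
  have LTX: "L\<^sup>T * X \<in> carrier_mat k n" using LT X by simp
  define Y where "Y = L\<^sup>T * X * L"
  have Y: "Y \<in> carrier_mat k k" unfolding Y_def using LTX L by simp
  define Q where "Q a b = (\<Sum>s<N. (H s *\<^sub>v a) \<bullet> (H s *\<^sub>v b))" for a b
  have Hc: "H s *\<^sub>v a \<in> carrier_vec k" if "a \<in> carrier_vec n" for s a using H that by (rule mult_mat_vec_carrier)
  have Lc: "L *\<^sub>v v \<in> carrier_vec n" if "v \<in> carrier_vec k" for v using L that by (rule mult_mat_vec_carrier)
  have pairing: "v \<bullet> (L\<^sup>T * X *\<^sub>v b) = Q (L *\<^sub>v v) b" if v: "v \<in> carrier_vec k" and b: "b \<in> carrier_vec n" for v b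
  proof -
    have "v \<bullet> (L\<^sup>T * X *\<^sub>v b) = v \<bullet> (L\<^sup>T *\<^sub>v (X *\<^sub>v b))" using assoc_mult_mat_vec[OF LT X b] by simp
    also have "\<dots> = (L *\<^sub>v v) \<bullet> (X *\<^sub>v b)"
      by (rule transpose_scalar_prod[OF L v mult_mat_vec_carrier[OF X b]])
    also have "\<dots> = Q (L *\<^sub>v v) b" unfolding X_def Q_def by (rule gram_form[OF H Lc[OF v] b])
    finally show ?thesis .
  qed
  have form: "v \<bullet> (Y *\<^sub>v w) = Q (L *\<^sub>v v) (L *\<^sub>v w)" if v: "v \<in> carrier_vec k" and w: "w \<in> carrier_vec k" for v w
    unfolding Y_def assoc_mult_mat_vec[OF LTX L w] by (rule pairing[OF v Lc[OF w]])
  have Q_ge0: "0 \<le> Q a a" for a unfolding Q_def by (intro sum_nonneg scalar_prod_self_nonneg)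
  have HL: "H s *\<^sub>v (L *\<^sub>v v) = H s * L *\<^sub>v v" if "v \<in> carrier_vec k" for s v
    using assoc_mult_mat_vec[OF H L that] by simp
  have Q_pos: "v \<bullet> v \<le> Q (L *\<^sub>v v) (L *\<^sub>v v)" if v: "v \<in> carrier_vec k" for v
  proof -
    have "v \<bullet> v = (H 0 *\<^sub>v (L *\<^sub>v v)) \<bullet> (H 0 *\<^sub>v (L *\<^sub>v v))" unfolding HL[OF v] H0 using v by simp
    also have "\<dots> \<le> Q (L *\<^sub>v v) (L *\<^sub>v v)"
      unfolding Q_def using N by (intro member_le_sum[of 0]) (auto intro: scalar_prod_self_nonneg)
    finally show ?thesis .
  qed
  have ker: "v = 0\<^sub>v k" if v: "v \<in> carrier_vec k" and 0: "Y *\<^sub>v v = 0\<^sub>v k" for v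
  proof -
    have "v \<bullet> v \<le> 0" using Q_pos[OF v] form[OF v v] 0 v by simp
    then show ?thesis using scalar_prod_self_eq_0[OF v] scalar_prod_self_nonneg[of v] by linarith
  qed
  define J where "J = mat_inv Y"
  have J: "J \<in> carrier_mat k k" "Y * J = 1\<^sub>m k" "J * Y = 1\<^sub>m k"
    unfolding J_def using mat_inv_trivial_kernel[OF Y] ker by blast+
  define F where "F = J * (L\<^sup>T * X)"
  have F: "F \<in> carrier_mat k n" unfolding F_def using J(1) LTX by simp
  have "F * L = J * Y" unfolding F_def Y_def by (rule assoc_mult_mat[OF J(1) LTX L])
  then have "F * L = 1\<^sub>m k" using J(3) by simp
  moreover have "F * E = 0\<^sub>m k q"
  proof -
    have "X * E = 0\<^sub>m n q" unfolding X_def by (rule gram_mult_zero[OF H E HE])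
    then have "L\<^sup>T * X * E = 0\<^sub>m k q" using assoc_mult_mat[OF LT X E] LT by simp
    then show ?thesis using assoc_mult_mat[OF J(1) LTX E] J(1) unfolding F_def by simp
  qed
  moreover have "schur_stable (F * A * L)"
  proof (rule schur_stable_if_decreasing_quadratic_form[OF _ Y])
    show S: "F * A * L \<in> carrier_mat k k" using F A L by simp
    show "0 \<le> v \<bullet> (Y *\<^sub>v v)" if "v \<in> carrier_vec k" for v using form[OF that that] Q_ge0 by simp
    fix v :: "real vec" assume v: "v \<in> carrier_vec k" "v \<noteq> 0\<^sub>v k"
    define b where "b = A *\<^sub>v (L *\<^sub>v v)"
    define w where "w = F *\<^sub>v b"
    have b: "b \<in> carrier_vec n" unfolding b_def using A Lc[OF v(1)] by simp
    have w: "w \<in> carrier_vec k" unfolding w_def using F b by simp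
    have Sv: "F * A * L *\<^sub>v v = w" unfolding w_def b_def
      using assoc_mult_mat_vec[OF mult_carrier_mat[OF F A] L v(1)] assoc_mult_mat_vec[OF F A Lc[OF v(1)]] by simp
    have "Y *\<^sub>v w = Y * J *\<^sub>v (L\<^sup>T * X *\<^sub>v b)"
      unfolding w_def F_def using assoc_mult_mat_vec[OF J(1) LTX b] assoc_mult_mat_vec[OF Y J(1) mult_mat_vec_carrier[OF LTX b]] by simp
    then have Yw: "Y *\<^sub>v w = L\<^sup>T * X *\<^sub>v b" unfolding J(2) using mult_mat_vec_carrier[OF LTX b] by simp
    \<comment> \<open>The residual \<open>b - L w\<close> is \<open>Q\<close>-orthogonal to \<open>L w\<close>.\<close>
    have cross: "Q (L *\<^sub>v w) b = Q (L *\<^sub>v w) (L *\<^sub>v w)"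
      using form[OF w w] pairing[OF w b] unfolding Yw by simp
    have Q_sym: "Q b (L *\<^sub>v w) = Q (L *\<^sub>v w) b"
      unfolding Q_def by (intro sum.cong refl comm_scalar_prod[OF Hc[OF b] Hc[OF Lc[OF w]]])
    have "0 \<le> Q (b - L *\<^sub>v w) (b - L *\<^sub>v w)" by (rule Q_ge0)
    also have "\<dots> = Q b b - Q b (L *\<^sub>v w) - Q (L *\<^sub>v w) b + Q (L *\<^sub>v w) (L *\<^sub>v w)"
    proof -
      have "(H s *\<^sub>v (b - L *\<^sub>v w)) \<bullet> (H s *\<^sub>v (b - L *\<^sub>v w)) =
         (H s *\<^sub>v b) \<bullet> (H s *\<^sub>v b) - (H s *\<^sub>v b) \<bullet> (H s *\<^sub>v (L *\<^sub>v w))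
         - (H s *\<^sub>v (L *\<^sub>v w)) \<bullet> (H s *\<^sub>v b) + (H s *\<^sub>v (L *\<^sub>v w)) \<bullet> (H s *\<^sub>v (L *\<^sub>v w))" for s
        unfolding mult_minus_distrib_mat_vec[OF H b Lc[OF w]]
        using Hc[OF b, of s] Hc[OF Lc[OF w], of s]
        by (simp add: minus_scalar_prod_distrib[of _ k] scalar_prod_minus_distrib[of _ k])
      then show ?thesis unfolding Q_def by (simp add: sum.distrib sum_subtractf)
    qed
    finally have "Q (L *\<^sub>v w) (L *\<^sub>v w) \<le> Q b b" unfolding Q_sym cross by simp
    also have "Q b b = (\<Sum>s<N. (H (Suc s) *\<^sub>v (L *\<^sub>v v)) \<bullet> (H (Suc s) *\<^sub>v (L *\<^sub>v v)))"
    proof -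
      have "H s *\<^sub>v b = H (Suc s) *\<^sub>v (L *\<^sub>v v)" for s
        unfolding b_def HL[OF v(1)] HSuc
        using assoc_mult_mat_vec[OF mult_carrier_mat[OF H A] L v(1)] assoc_mult_mat_vec[OF H A Lc[OF v(1)]] by simp
      then show ?thesis unfolding Q_def by simp
    qed
    also have "\<dots> = Q (L *\<^sub>v v) (L *\<^sub>v v) - v \<bullet> v + (H N * L *\<^sub>v v) \<bullet> (H N * L *\<^sub>v v)"
    proof -
      define f where "f s = (H s *\<^sub>v (L *\<^sub>v v)) \<bullet> (H s *\<^sub>v (L *\<^sub>v v))" for s
      have "f 0 = v \<bullet> v" unfolding f_def HL[OF v(1)] H0 using v by simp
      moreover have "f N = (H N * L *\<^sub>v v) \<bullet> (H N * L *\<^sub>v v)" unfolding f_def HL[OF v(1)] ..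
      moreover have "f 0 + (\<Sum>s<N. f (Suc s)) = (\<Sum>s<N. f s) + f N"
        using sum.lessThan_Suc_shift[of f N] by simp
      ultimately show ?thesis unfolding Q_def f_def[symmetric] by simp
    qed
    also have "\<dots> < Q (L *\<^sub>v v) (L *\<^sub>v v)" using small[OF v] by simp
    finally show "(F * A * L *\<^sub>v v) \<bullet> (Y *\<^sub>v (F * A * L *\<^sub>v v)) < v \<bullet> (Y *\<^sub>v v)"
      unfolding Sv form[OF w w] form[OF v(1) v(1)] .
  qed
  ultimately show ?thesis using F by blast
qed

section \<open>From an observer to the data equation\<close>

context output_coordinates
begin

text \<open>
  The matrices \<open>S1\<close> to \<open>S4\<close> are in general not those of the given observer; the observer only
  supplies, through its error response, the form whose orthogonal projection defines \<open>F\<close>.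
\<close>

lemma rUIO_imp_data_equation:
  assumes A: "A \<in> carrier_mat n n" and B: "B \<in> carrier_mat n m" and E: "E \<in> carrier_mat n q"
    and O: "AU \<in> carrier_mat k k" "Bu \<in> carrier_mat k m" "By \<in> carrier_mat k p" "DU \<in> carrier_mat k p"
    and conv: "\<And>u d x y z. sys_trajectory A B E C u d x y \<Longrightarrow> observer_state AU Bu By u y z \<Longrightarrow>
        vec_tendsto_zero k (\<lambda>t. (P - DU * C) *\<^sub>v x t - z t)"
  shows "\<exists>S1 S2 S3 S4. S1 \<in> carrier_mat k m \<and> S2 \<in> carrier_mat k p \<and> S3 \<in> carrier_mat k p \<and> S4 \<in> carrier_mat k k \<and>
    schur_stable S4 \<and>
    (\<forall>u d x x'. u \<in> carrier_vec m \<longrightarrow> d \<in> carrier_vec q \<longrightarrow> x \<in> carrier_vec n \<longrightarrow>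
      x' = A *\<^sub>v x + B *\<^sub>v u + E *\<^sub>v d \<longrightarrow>
      P *\<^sub>v x' = S1 *\<^sub>v u + (S2 *\<^sub>v (C *\<^sub>v x) + (S3 *\<^sub>v (C *\<^sub>v x') + S4 *\<^sub>v (P *\<^sub>v x))))"
proof -
  define F0 where "F0 = P - DU * C"
  define H where "H = error_response F0 AU (By * C) A"
  have F0: "F0 \<in> carrier_mat k n" unfolding F0_def by (rule minus_carrier_mat[OF mult_carrier_mat[OF O(4) C]])
  have R: "By * C \<in> carrier_mat k n" using O C by simp
  have H: "H t \<in> carrier_mat k n" for t unfolding H_def using F0 O(1) R A by (rule error_response_carrier)
  have Hlim: "vec_tendsto_zero k (\<lambda>t. H t *\<^sub>v v)" if "v \<in> carrier_vec n" for v
    unfolding H_def by (rule rUIO_imp_error_response(1)[OF A B E O(1-3) F0 conv[folded F0_def] that])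
  have HE: "H s * E = 0\<^sub>m k q" for s
    unfolding H_def by (rule rUIO_imp_error_response(2)[OF A B E O(1-3) F0 conv[folded F0_def]])
  have GCL: "G * C * L = 0\<^sub>m r k" if "G \<in> carrier_mat r p" for G r
    using assoc_mult_mat[OF that C L] that unfolding CL by simp
  have H0: "H 0 * L = 1\<^sub>m k"
    using minus_mult_distrib_mat[OF P mult_carrier_mat[OF O(4) C] L] GCL[OF O(4)] PL minus_zero_mat[of "1\<^sub>m k" k k]
    unfolding H_def F0_def by simp
  have HSuc: "H (Suc s) * L = H s * A * L" for s
  proof -
    have G: "AU ^\<^sub>m s * By \<in> carrier_mat k p" using pow_carrier_mat[OF O(1)] O(3) by (rule mult_carrier_mat)
    have "H (Suc s) * L = H s * A * L - AU ^\<^sub>m s * (By * C) * L"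
      unfolding H_def error_response.simps
      by (rule minus_mult_distrib_mat[OF mult_carrier_mat[OF H[unfolded H_def] A] mult_carrier_mat[OF pow_carrier_mat[OF O(1)] R] L])
    also have "AU ^\<^sub>m s * (By * C) * L = 0\<^sub>m k k"
      using GCL[OF G] assoc_mult_mat[OF pow_carrier_mat[OF O(1)] O(3) C] by simp
    finally show ?thesis using minus_zero_mat[OF mult_carrier_mat[OF mult_carrier_mat[OF H A] L]] by simp
  qed
  have "(\<lambda>t. \<Sum>i<k. \<Sum>j<k. ((H t * L) $$ (i, j))\<^sup>2) \<longlonglongrightarrow> 0"
  proof (intro tendsto_null_sum)
    fix i j assume "i \<in> {..<k}" "j \<in> {..<k}"
    then have ij: "i < k" "j < k" by auto
    have "(\<lambda>t. (H t *\<^sub>v col L j) $ i) \<longlonglongrightarrow> 0"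
      using Hlim[of "col L j"] L ij unfolding vec_tendsto_zero_def by auto
    moreover have "(H t *\<^sub>v col L j) $ i = (H t * L) $$ (i, j)" for t
      using ij carrier_matD[OF H[of t]] carrier_matD[OF L] by simp
    ultimately show "(\<lambda>t. ((H t * L) $$ (i, j))\<^sup>2) \<longlonglongrightarrow> 0"
      using tendsto_power[of "\<lambda>t. (H t * L) $$ (i, j)" 0 sequentially 2] by simp
  qed
  then have "\<forall>\<^sub>F t in sequentially. (\<Sum>i<k. \<Sum>j<k. ((H t * L) $$ (i, j))\<^sup>2) < 1"
    by (rule order_tendstoD(2)) simp
  then obtain N0 where N0: "\<And>t. t \<ge> N0 \<Longrightarrow> (\<Sum>i<k. \<Sum>j<k. ((H t * L) $$ (i, j))\<^sup>2) < 1"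
    unfolding eventually_sequentially by blast
  \<comment> \<open>A positive \<open>N\<close> makes \<open>H 0\<close> contribute to the Gram form.\<close>
  define N where "N = Suc N0"
  have "(H N * L *\<^sub>v v) \<bullet> (H N * L *\<^sub>v v) < v \<bullet> v" if "v \<in> carrier_vec k" "v \<noteq> 0\<^sub>v k" for v
    by (rule small_entries_contract[OF mult_carrier_mat[OF H L] N0 that]) (simp add: N_def)
  from stabilizing_left_inverse[OF H A L E H0 HSuc HE this]
  obtain F where F: "F \<in> carrier_mat k n" and FL: "F * L = 1\<^sub>m k" and FE: "F * E = 0\<^sub>m k q"
    and st: "schur_stable (F * A * L)" unfolding N_def by blast
  define S1 S2 S3 S4 where "S1 = F * B" and "S2 = F * A * K" and "S3 = (P - F) * K" and "S4 = F * A * L"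
  have FA: "F * A \<in> carrier_mat k n" using F A by simp
  have PF: "P - F \<in> carrier_mat k n" by (rule minus_carrier_mat[OF F])
  have S: "S1 \<in> carrier_mat k m" "S2 \<in> carrier_mat k p" "S3 \<in> carrier_mat k p" "S4 \<in> carrier_mat k k"
    unfolding S1_def S2_def S3_def S4_def using F FA PF B K L by simp_all
  have "(P - F) * L = 0\<^sub>m k k" using minus_mult_distrib_mat[OF P F L] unfolding PL FL by (auto intro!: eq_matI)
  from eq_if_vanishing_on_kernel[OF PF this] have PF_eq: "P - F = S3 * C" unfolding S3_def .
  have "P *\<^sub>v x' = S1 *\<^sub>v u + (S2 *\<^sub>v (C *\<^sub>v x) + (S3 *\<^sub>v (C *\<^sub>v x') + S4 *\<^sub>v (P *\<^sub>v x)))"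
    if u: "u \<in> carrier_vec m" and d: "d \<in> carrier_vec q" and x: "x \<in> carrier_vec n"
      and x': "x' = A *\<^sub>v x + B *\<^sub>v u + E *\<^sub>v d" for u d x x'
  proof -
    have Ax: "A *\<^sub>v x \<in> carrier_vec n" and Bu: "B *\<^sub>v u \<in> carrier_vec n" and Ed: "E *\<^sub>v d \<in> carrier_vec n"
      using A B E x u d by (auto intro: mult_mat_vec_carrier)
    have x'c: "x' \<in> carrier_vec n" unfolding x' using Ax Bu Ed by simp
    have Px: "P *\<^sub>v x \<in> carrier_vec k" using P x by (rule mult_mat_vec_carrier)
    have Cx: "C *\<^sub>v x \<in> carrier_vec p" using C x by (rule mult_mat_vec_carrier)
    have Cx': "C *\<^sub>v x' \<in> carrier_vec p" using C x'c by (rule mult_mat_vec_carrier)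
    define a b c f l where "a = S2 *\<^sub>v (C *\<^sub>v x)" and "b = S4 *\<^sub>v (P *\<^sub>v x)" and "c = S1 *\<^sub>v u"
      and "f = F *\<^sub>v x'" and "l = S3 *\<^sub>v (C *\<^sub>v x')"
    have car: "a \<in> carrier_vec k" "b \<in> carrier_vec k" "c \<in> carrier_vec k" "f \<in> carrier_vec k" "l \<in> carrier_vec k"
      unfolding a_def b_def c_def f_def l_def
      using mult_mat_vec_carrier[OF S(2) Cx] mult_mat_vec_carrier[OF S(4) Px] mult_mat_vec_carrier[OF S(1) u]
        mult_mat_vec_carrier[OF F x'c] mult_mat_vec_carrier[OF S(3) Cx'] by blast+
    have "F *\<^sub>v (A *\<^sub>v x) = F * A *\<^sub>v (L *\<^sub>v (P *\<^sub>v x) + K *\<^sub>v (C *\<^sub>v x))"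
      unfolding decompose_vec[OF x] assoc_mult_mat_vec[OF F A x] ..
    also have "\<dots> = b + a"
      unfolding b_def a_def S4_def S2_def assoc_mult_mat_vec[OF FA L Px] assoc_mult_mat_vec[OF FA K Cx]
      by (rule mult_add_distrib_mat_vec[OF FA mult_mat_vec_carrier[OF L Px] mult_mat_vec_carrier[OF K Cx]])
    finally have 1: "F *\<^sub>v (A *\<^sub>v x) = b + a" .
    have 2: "F *\<^sub>v (B *\<^sub>v u) = c" unfolding c_def S1_def assoc_mult_mat_vec[OF F B u] ..
    have 3: "F *\<^sub>v (E *\<^sub>v d) = 0\<^sub>v k"
      unfolding assoc_mult_mat_vec[OF F E d, symmetric] FE by (rule zero_mat_mult_vec[OF d])
    have 4: "f = b + a + c + 0\<^sub>v k"
      unfolding f_def x' mult_add_distrib_mat_vec[OF F add_carrier_vec[OF Ax Bu] Ed] mult_add_distrib_mat_vec[OF F Ax Bu] 1 2 3 ..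
    have "P *\<^sub>v x' - f = l"
      unfolding f_def l_def minus_mult_distrib_mat_vec[OF P F x'c, symmetric] PF_eq by (rule assoc_mult_mat_vec[OF S(3) C x'c])
    moreover have "v = f + (v - f)" if "v \<in> carrier_vec k" for v
      using car that by (intro eq_vecI) auto
    ultimately have "P *\<^sub>v x' = f + l" using mult_mat_vec_carrier[OF P x'c] by metis
    then show ?thesis unfolding 4 a_def[symmetric] b_def[symmetric] c_def[symmetric] l_def[symmetric]
      using car by (auto intro!: eq_vecI)
  qed
  with S st[folded S4_def] show ?thesis by blast
qed

end

section \<open>Existence of observers\<close>

theorem theorem9:
  fixes n m p q T :: nat
    and A B E C C1 C2 :: "real mat"
    and u_d d_d x_d y_d :: "nat \<Rightarrow> real vec"
  assumes A: "A \<in> carrier_mat n n"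
    and B: "B \<in> carrier_mat n m"
    and E: "E \<in> carrier_mat n q" "vec_space.rank n E = q"
    and C: "C \<in> carrier_mat p n" "vec_space.rank p C = p"
    and C1: "C1 \<in> carrier_mat p (n - p)"
    and C2: "C2 \<in> carrier_mat p p" "invertible_mat C2"
    and C_split: "C = C1 @\<^sub>c C2"
    and T: "T \<ge> 1"
    and data: "data_trajectory T A B E C u_d d_d x_d y_d"
    and rank: "vec_space.rank (m + q + n)
                 (past_mat T m u_d @\<^sub>r past_mat T q d_d @\<^sub>r past_mat T n x_d) = m + q + n"
  shows "((\<exists>AU Bu By DU. is_rUIO A B E C1 C2 AU Bu By DU \<and>
                         designed_from_data T n m p u_d y_d x_d C AU Bu By DU) \<longleftrightarrow>
          (\<exists>S1 S2 S3 S4. data_solution T n m p u_d y_d x_d S1 S2 S3 S4 \<and> schur_stable S4))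
       \<and> ((\<exists>AU Bu By DU. is_rUIO A B E C1 C2 AU Bu By DU) \<longleftrightarrow>
          (\<exists>S1 S2 S3 S4. data_solution T n m p u_d y_d x_d S1 S2 S3 S4 \<and> schur_stable S4))"
proof -
  define k where "k = n - p"
  have "C1 @\<^sub>c C2 \<in> carrier_mat p (n - p + p)" using append_cols_carrier[OF C1 C2(1)] .
  then have n: "n = k + p" using C(1) unfolding C_split k_def by auto
  note C1 = C1[folded k_def]
  define P L K where "P = (1\<^sub>m k :: real mat) @\<^sub>c 0\<^sub>m k p" and "L = 1\<^sub>m k @\<^sub>r (- (mat_inv C2 * C1))"
    and "K = 0\<^sub>m k p @\<^sub>r mat_inv C2"
  interpret output_coordinates n k p P L K C
    unfolding P_def L_def K_def C_split n by (rule output_coordinates_split(1)[OF C1 C2])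
  have u: "u_d t \<in> carrier_vec m" and d: "d_d t \<in> carrier_vec q"
    and xS: "x_d (Suc t) = A *\<^sub>v x_d t + B *\<^sub>v u_d t + E *\<^sub>v d_d t" if "t < T - 1" for t
    using data A B E that unfolding data_trajectory_def by auto
  have x: "x_d t \<in> carrier_vec n" and y: "y_d t = C *\<^sub>v x_d t" if "t < T" for t
    using data A that unfolding data_trajectory_def by auto
  have yc: "y_d t \<in> carrier_vec p" if "t < T" for t
    unfolding y[OF that] using C(1) x[OF that] by (rule mult_mat_vec_carrier)
  have x': "x_d t \<in> carrier_vec n" and y': "y_d t = C *\<^sub>v x_d t" if "t < T - 1" for t
    using x y that by auto
  have head: "vec_first (x_d t) (n - p) = P *\<^sub>v x_d t" if "t < T" for t
    using head_mult_vec[of "x_d t" k p] x[OF that] unfolding P_def k_def[symmetric] n by simp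
  have sol_iff: "data_solution T n m p u_d y_d x_d S1 S2 S3 S4 \<longleftrightarrow>
      (\<forall>t<T - 1. P *\<^sub>v x_d (Suc t) =
        S1 *\<^sub>v u_d t + (S2 *\<^sub>v (C *\<^sub>v x_d t) + (S3 *\<^sub>v (C *\<^sub>v x_d (Suc t)) + S4 *\<^sub>v (P *\<^sub>v x_d t))))"
    if "S1 \<in> carrier_mat k m" "S2 \<in> carrier_mat k p" "S3 \<in> carrier_mat k p" "S4 \<in> carrier_mat k k" for S1 S2 S3 S4
    using data_solution_iff[OF u yc that[unfolded k_def], of T] head y by simp
  note rUIO_iff = is_rUIO_iff_reduced_error[of A k p B m, OF A[unfolded n] B[unfolded n] C1 C2, folded C_split P_def]
  have necessity: "\<exists>S1 S2 S3 S4. data_solution T n m p u_d y_d x_d S1 S2 S3 S4 \<and> schur_stable S4"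
    if "is_rUIO A B E C1 C2 AU Bu By DU" for AU Bu By DU
  proof -
    note O = that[unfolded rUIO_iff]
    have conv: "vec_tendsto_zero k (\<lambda>t. (P - DU * C) *\<^sub>v x t - z t)"
      if "sys_trajectory A B E C u d x y" "observer_state AU Bu By u y z" for u d x y z
      using O that by blast
    obtain S1 S2 S3 S4 where S: "S1 \<in> carrier_mat k m" "S2 \<in> carrier_mat k p" "S3 \<in> carrier_mat k p" "S4 \<in> carrier_mat k k"
      and st: "schur_stable S4"
      and eq: "\<And>u d x x'. u \<in> carrier_vec m \<Longrightarrow> d \<in> carrier_vec q \<Longrightarrow> x \<in> carrier_vec n \<Longrightarrow>
        x' = A *\<^sub>v x + B *\<^sub>v u + E *\<^sub>v d \<Longrightarrow>
        P *\<^sub>v x' = S1 *\<^sub>v u + (S2 *\<^sub>v (C *\<^sub>v x) + (S3 *\<^sub>v (C *\<^sub>v x') + S4 *\<^sub>v (P *\<^sub>v x)))"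
      using rUIO_imp_data_equation[OF A B E(1), of AU Bu By DU] O conv by blast
    have "data_solution T n m p u_d y_d x_d S1 S2 S3 S4"
      unfolding sol_iff[OF S] using eq[OF u d x' xS] by blast
    with st show ?thesis by blast
  qed
  have sufficiency: "is_rUIO A B E C1 C2 S4 S1 (S2 + S4 * S3) S3 \<and>
      designed_from_data T n m p u_d y_d x_d C S4 S1 (S2 + S4 * S3) S3"
    if sol: "data_solution T n m p u_d y_d x_d S1 S2 S3 S4" and st: "schur_stable S4" for S1 S2 S3 S4
  proof
    have S: "S1 \<in> carrier_mat k m" "S2 \<in> carrier_mat k p" "S3 \<in> carrier_mat k p" "S4 \<in> carrier_mat k k"
      using sol unfolding data_solution_def k_def[symmetric] by blast+
    note eqs = data_equation_imp_observer_equations[OF A B E(1) S u d x' rank xS sol[unfolded sol_iff[OF S], rule_format]]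
    show "is_rUIO A B E C1 C2 S4 S1 (S2 + S4 * S3) S3"
      unfolding rUIO_iff using S observer_equations_imp_error_tendsto_zero[OF A B E(1) S refl eqs st]
      by (auto intro!: add_carrier_mat mult_carrier_mat)
    show "designed_from_data T n m p u_d y_d x_d C S4 S1 (S2 + S4 * S3) S3"
      unfolding designed_from_data_def Let_def
      using output_matrix_from_data[OF u d x' C(1) y' rank] sol by blast
  qed
  show ?thesis using necessity sufficiency by blast
qed

end
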